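(* Let $\alpha>0$ and let $a=\{a_k\}_{k\ge 1}\subset D$ be a sequence with $a_k\ne a_n$ if $k\ne n$ and $|a_k|\le |a_{k+1}|$ for all $k\ge 1$, satisfying the Newman–Carleson condition $(N\text{-}C)$ and the Stoltz condition $(S)$. Then: a) If $g\in F_\alpha$, then $\{(1-a_k)^{\alpha}g(a_k)\}_{k\ge 1}\in b_v$. b) For each sequence $x=\{x_k\}_{k\ge 1}\in b_v$ there is a function $g\in F_\alpha$ such that $(1-a_k)^{\alpha}g(a_k)=x_k$ for all $k=1,2,\ldots$.
   Context: $D$ is the open unit disk in $\mathbb{C}$ and $T$ is the unit circle. $M$ is the Banach space of all complex-valued Borel measures on $T$ with the variation norm. For $\alpha>0$, $F_\alpha$ is the family of all functions $g$ on $D$ for which there exists $\mu\in M$ such that $$g(z)=\int_T \frac{1}{(1-\overline{\zeta}z)^{\alpha}}\,d\mu(\zeta),\qquad z\in D.$$ All powers $(1-w)^\alpha$ with $|w|<1$ are the principal branch (equal to $1$ at $w=0$). A sequence $a=\{a_k\}_{k\ge1}\subset D$ satisfies the Newman–Carleson condition $(N\text{-}C)$ if $$\delta(a)=\inf_{n\ge 1}\ \prod_{k\ne n}\left|\frac{a_k-a_n}{1-\overline{a}_k a_n}\right|>0.$$ It satisfies the Stoltz condition $(S)$ if $$\sup_{k\ge 1}\frac{|1-a_k|}{1-|a_k|}<\infty.$$ $b_v$ is the set of complex sequences $x=\{x_k\}_{k\ge1}$ with $\sum_{k\ge 1}|x_{k+1}-x_k|<\infty$. *)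

theory Defs
  imports "HOL-Analysis.Analysis"
begin

text \<open>
  A complex measure on the sigma-algebra of \<open>M\<close> is a countably additive complex-valued set function
  (only \<open>sets M\<close> and \<open>space M\<close> matter, not the measure carried by \<open>M\<close>). The case where all sets are
  empty forces the value 0 at the empty set. Values outside \<open>sets M\<close> are irrelevant.
\<close>

definition complex_measure :: "'a measure \<Rightarrow> ('a set \<Rightarrow> complex) \<Rightarrow> bool" where
  "complex_measure M \<nu> \<longleftrightarrow>
     (\<forall>A :: nat \<Rightarrow> 'a set. range A \<subseteq> sets M \<longrightarrow> disjoint_family A \<longrightarrow>
        (\<lambda>n. \<nu> (A n)) sums \<nu> (\<Union>n. A n))"

text \<open>
  The positive part of the Jordan decomposition of a real signed measure \<open>\<sigma>\<close>, i.e. its upper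
  variation: the supremum of \<open>\<sigma> B\<close> over measurable \<open>B \<subseteq> A\<close>. The truncation of negative values by
  \<open>ennreal\<close> does not affect the supremum, since \<open>B = {}\<close> already contributes 0. The negative part
  is the upper variation of \<open>-\<sigma>\<close>.
\<close>

definition upper_variation :: "'a measure \<Rightarrow> ('a set \<Rightarrow> real) \<Rightarrow> 'a measure" where
  "upper_variation M \<sigma> =
     measure_of (space M) (sets M) (\<lambda>A. SUP B\<in>{B \<in> sets M. B \<subseteq> A}. ennreal (\<sigma> B))"

definition complex_measure_integral ::
    "'a measure \<Rightarrow> ('a set \<Rightarrow> complex) \<Rightarrow> ('a \<Rightarrow> complex) \<Rightarrow> complex" where
  "complex_measure_integral M \<nu> f =
     ((LINT t|upper_variation M (\<lambda>A. Re (\<nu> A)). f t) -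
      (LINT t|upper_variation M (\<lambda>A. - Re (\<nu> A)). f t)) +
     \<i> * ((LINT t|upper_variation M (\<lambda>A. Im (\<nu> A)). f t) -
          (LINT t|upper_variation M (\<lambda>A. - Im (\<nu> A)). f t))"

abbreviation circle_borel :: "complex measure" where
  "circle_borel \<equiv> restrict_space borel (sphere 0 1)"

text \<open>
  Functions on the unit disk are represented by total functions whose values off the disk are
  unconstrained. Complex \<open>powr\<close> is the principal branch.
\<close>

definition F_space :: "real \<Rightarrow> (complex \<Rightarrow> complex) set" where
  "F_space \<alpha> =
     {g. \<exists>\<nu>. complex_measure circle_borel \<nu> \<and>
          (\<forall>z\<in>ball 0 1. g z =
             complex_measure_integral circle_borel \<nu>
               (\<lambda>\<zeta>. 1 / (1 - cnj \<zeta> * z) powr of_real \<alpha>))}"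

text \<open>
  Sequences are indexed from 0. The infinite product is taken as the limit of its partial products,
  which for points of the disk are decreasing and nonnegative. The library's \<open>prodinf\<close> is unsuitable
  because it is unspecified when the partial products of nonzero factors tend to 0.
\<close>

definition nc_delta :: "(nat \<Rightarrow> complex) \<Rightarrow> real" where
  "nc_delta a =
     (INF n. lim (\<lambda>N. \<Prod>k\<in>{..<N} - {n}. cmod ((a k - a n) / (1 - cnj (a k) * a n))))"

definition newman_carleson :: "(nat \<Rightarrow> complex) \<Rightarrow> bool" where
  "newman_carleson a \<longleftrightarrow> nc_delta a > 0"

definition stoltz :: "(nat \<Rightarrow> complex) \<Rightarrow> bool" where
  "stoltz a \<longleftrightarrow> bdd_above (range (\<lambda>k. cmod (1 - a k) / (1 - cmod (a k))))"

definition bv_seq :: "(nat \<Rightarrow> complex) set" where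
  "bv_seq = {x. summable (\<lambda>k. cmod (x (Suc k) - x k))}"

end

theory Submission
  imports Defs "HOL-Complex_Analysis.Complex_Analysis"
begin

text \<open>
  Write \<open>d\<^sub>k = 1 - |a\<^sub>k|\<close>. In a Stoltz angle the Newman--Carleson condition forces \<open>d\<close> to decay
  geometrically, \<open>d\<^bsub>n+m\<^esub> \<le> K q\<^sup>m d\<^sub>n\<close>. The normalised kernels
  \<open>\<Phi>\<^sub>\<zeta>(k) = ((1 - a\<^sub>k) / (1 - cnj \<zeta> a\<^sub>k)) powr \<alpha>\<close> are therefore, uniformly in the point \<open>\<zeta>\<close> of
  the circle and up to a bounded error in \<open>\<ell>\<^sup>1\<close>, step functions with a single jump where \<open>d\<^sub>k\<close> passes
  \<open>|1 - \<zeta>|\<close>; so their variation is bounded, and integration gives part a).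

  Conversely, a sequence in \<open>b\<^sub>v\<close> is an absolutely convergent combination of step functions, and
  replacing each of them by a kernel leaves an error in \<open>\<ell>\<^sup>1\<close>. Data in \<open>\<ell>\<^sup>1\<close> are interpolated by a
  Neumann series from functions localised at \<open>a\<^sub>n\<close>: with \<open>b = 1 - d\<^sub>n / 2\<close> and
  \<open>s = (1 - b) / (1 - b z)\<close>, take \<open>(1 - b z) powr (-\<alpha>)\<close> times a power of \<open>s (1 - s)\<close> (decay away from
  \<open>a\<^sub>n\<close>) times linear factors in \<open>s\<close> that vanish at the boundedly many nearby points. By Cauchy's
  formula for the derivatives of \<open>w \<mapsto> (1 - w z) powr (-\<alpha>)\<close> at \<open>b\<close> such a function is the transform of
  an \<open>L\<^sup>1\<close> density on the circle whose norm depends on the degree only.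
\<close>

section \<open>Complex measures with a density and their push-forwards\<close>

text \<open>The Neumann series requires the values of the \<open>n\<close>-th localised function at
  the other points, relative to its value at \<open>a n\<close>, to sum to at most 1/2. Decay away
  from \<open>a n\<close> cannot achieve this alone, since nothing makes it effective at
  neighbouring points; hence the zeros at all points of index distance at most \<open>R\<close>.
  Each zero may shrink the value at \<open>a n\<close> by a constant factor, so normalisation costs
  a factor exponential in \<open>R\<close>. The way out is the order of choice: the decay exponent
  \<open>E\<close> is fixed before \<open>R\<close>, so large that beyond index distance
  \<open>R\<close> half of the decay pays this cost, and then a large \<open>R\<close> makes the
  remainder small. Neither number depends on \<open>n\<close>, so the densities have uniformly
  bounded norms and can be summed.

  The integral is defined by upper variations. Part a) works with them as finite positive measures;
  part b) has to compute them for images of densities, where masses of opposite sign may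
  meet.\<close>

lemma signed_measure_bounded:
  fixes \<sigma> :: "'a set \<Rightarrow> real"
  assumes ca: "\<And>A :: nat \<Rightarrow> 'a set. range A \<subseteq> sets M \<Longrightarrow> disjoint_family A \<Longrightarrow>
      (\<lambda>n. \<sigma> (A n)) sums \<sigma> (\<Union>n. A n)"
  shows "\<exists>C. \<forall>A\<in>sets M. \<bar>\<sigma> A\<bar> \<le> C"
proof (rule ccontr)
  assume unbdd: "\<not> ?thesis"
  have empty: "\<sigma> {} = 0"
  proof -
    have "(\<lambda>n::nat. \<sigma> {}) sums \<sigma> (\<Union>n::nat. {})"
      by (rule ca) (auto simp: disjoint_family_on_def)
    then show ?thesis
      by (auto simp: sums_iff summable_const_iff)
  qed
  have add: "\<sigma> (A \<union> B) = \<sigma> A + \<sigma> B" if "A \<in> sets M" "B \<in> sets M" "A \<inter> B = {}" for A B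
  proof -
    have "(\<lambda>n. \<sigma> (binaryset A B n)) sums \<sigma> (\<Union>n. binaryset A B n)"
      by (rule ca) (use that in \<open>auto simp: binaryset_def disjoint_family_on_def\<close>)
    moreover have "(\<lambda>n. \<sigma> (binaryset A B n)) sums (\<sigma> A + \<sigma> B)"
      by (rule binaryset_sums) (rule empty)
    ultimately show ?thesis
      using sums_unique2 UN_binaryset_eq by metis
  qed
  \<comment> \<open>Unboundedness on subsets is inherited: a bad set splits into two pieces on each
    of which the absolute value of \<open>\<sigma>\<close> is at least 1, and one of them is bad.
    Discarding the other piece forever yields disjoint sets whose values do not tend to 0.\<close>
  define bad where "bad A \<longleftrightarrow> A \<in> sets M \<and> \<not> (\<exists>C. \<forall>B\<in>sets M. B \<subseteq> A \<longrightarrow> \<bar>\<sigma> B\<bar> \<le> C)" for A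
  have step: "\<exists>B. bad B \<and> B \<subseteq> A \<and> 1 \<le> \<bar>\<sigma> (A - B)\<bar>" if A: "bad A" for A
  proof -
    have AM: "A \<in> sets M" using A by (simp add: bad_def)
    obtain B where B: "B \<in> sets M" "B \<subseteq> A" "\<bar>\<sigma> B\<bar> > \<bar>\<sigma> A\<bar> + 1"
      using A unfolding bad_def by (meson not_le)
    have eq: "\<sigma> A = \<sigma> B + \<sigma> (A - B)"
      using add[of B "A - B"] B AM by (simp add: Un_absorb1)
    show ?thesis
    proof (cases "bad B")
      case True
      have "1 \<le> \<bar>\<sigma> (A - B)\<bar>" using eq B(3) by linarith
      then show ?thesis using True B by blast
    next
      case False
      then obtain C where C: "\<And>D. D \<in> sets M \<Longrightarrow> D \<subseteq> B \<Longrightarrow> \<bar>\<sigma> D\<bar> \<le> C"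
        using B unfolding bad_def by blast
      have "bad (A - B)"
      proof (rule ccontr)
        assume "\<not> bad (A - B)"
        then obtain C' where C': "\<And>D. D \<in> sets M \<Longrightarrow> D \<subseteq> A - B \<Longrightarrow> \<bar>\<sigma> D\<bar> \<le> C'"
          using AM B unfolding bad_def by blast
        have "\<bar>\<sigma> D\<bar> \<le> C + C'" if D: "D \<in> sets M" "D \<subseteq> A" for D
        proof -
          have "(D \<inter> B) \<union> (D - B) = D" by blast
          then have "\<sigma> D = \<sigma> (D \<inter> B) + \<sigma> (D - B)"
            using add[of "D \<inter> B" "D - B"] D B by fastforce
          moreover have "\<bar>\<sigma> (D \<inter> B)\<bar> \<le> C" "\<bar>\<sigma> (D - B)\<bar> \<le> C'"
            using D B by (auto intro!: C C')
          ultimately show ?thesis by linarith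
        qed
        then show False using A unfolding bad_def by blast
      qed
      moreover have "A - (A - B) = B" using B by blast
      ultimately show ?thesis using B by (intro exI[of _ "A - B"]) auto
    qed
  qed
  have "bad (space M)"
    unfolding bad_def using unbdd by (meson sets.sets_into_space sets.top)
  then obtain S where S: "\<And>n. bad (S n)" "\<And>n. S (Suc n) \<subseteq> S n \<and> 1 \<le> \<bar>\<sigma> (S n - S (Suc n))\<bar>"
    using dependent_nat_choice[of "\<lambda>_. bad" "\<lambda>_ A B. B \<subseteq> A \<and> 1 \<le> \<bar>\<sigma> (A - B)\<bar>"] step by metis
  have dec: "S n \<subseteq> S m" if "m \<le> n" for m n
    using that by (induction n rule: dec_induct) (use S(2) in auto)
  have "disjoint_family (\<lambda>n. S n - S (Suc n))"
    unfolding disjoint_family_on_def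
  proof (intro ballI impI)
    fix m n :: nat assume "m \<noteq> n"
    then consider "Suc m \<le> n" | "Suc n \<le> m" by linarith
    then show "(S m - S (Suc m)) \<inter> (S n - S (Suc n)) = {}"
      by cases (use dec in blast)+
  qed
  moreover have "range (\<lambda>n. S n - S (Suc n)) \<subseteq> sets M"
    using S(1) by (auto simp: bad_def)
  ultimately have "summable (\<lambda>n. \<sigma> (S n - S (Suc n)))"
    using ca sums_summable by blast
  then have "(\<lambda>n. \<sigma> (S n - S (Suc n))) \<longlonglongrightarrow> 0"
    by (rule summable_LIMSEQ_zero)
  then obtain n where "\<bar>\<sigma> (S n - S (Suc n))\<bar> < 1"
    using LIMSEQ_D[of _ 0 1] by fastforce
  then show False using S(2)[of n] by linarith
qed

lemma sets_upper_variation [simp]: "sets (upper_variation M \<sigma>) = sets M"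
  by (simp add: upper_variation_def)

lemma space_upper_variation [simp]: "space (upper_variation M \<sigma>) = space M"
  by (simp add: upper_variation_def)

text \<open>\<open>measure_of\<close> falls back to the zero measure if the supremum is not
  countably additive, so in either case the total mass is at most the bound for
  \<open>\<sigma>\<close>.\<close>

lemma finite_measure_upper_variation:
  fixes \<sigma> :: "'a set \<Rightarrow> real"
  assumes "\<And>A :: nat \<Rightarrow> 'a set. range A \<subseteq> sets M \<Longrightarrow> disjoint_family A \<Longrightarrow>
      (\<lambda>n. \<sigma> (A n)) sums \<sigma> (\<Union>n. A n)"
  shows "finite_measure (upper_variation M \<sigma>)"
proof
  obtain C where C: "\<And>A. A \<in> sets M \<Longrightarrow> \<bar>\<sigma> A\<bar> \<le> C"
    using signed_measure_bounded[of M \<sigma>] assms by blast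
  have "(SUP B\<in>{B \<in> sets M. B \<subseteq> space M}. ennreal (\<sigma> B)) \<le> ennreal C"
    using C by (intro SUP_least ennreal_leI) (auto simp: abs_le_iff)
  then have "(SUP B\<in>{B \<in> sets M. B \<subseteq> space M}. ennreal (\<sigma> B)) \<noteq> \<infinity>"
    by (metis ennreal_less_top infinity_ennreal_def le_less_trans less_irrefl)
  then show "emeasure (upper_variation M \<sigma>) (space (upper_variation M \<sigma>)) \<noteq> \<infinity>"
    by (simp add: upper_variation_def emeasure_measure_of_conv)
qed

text \<open>The supremum over subsets of \<open>A\<close> is attained at the part of
  \<open>A\<close> where \<open>D\<close> is positive, the positive set of a Hahn
  decomposition.\<close>

lemma upper_variation_eq_density:
  fixes D :: "'a \<Rightarrow> real"
  assumes [measurable_cong]: "sets \<rho> = sets M" and D: "integrable \<rho> D"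
    and \<sigma>: "\<And>A. A \<in> sets M \<Longrightarrow> \<sigma> A = (\<integral>x. indicator A x * D x \<partial>\<rho>)"
  shows "upper_variation M \<sigma> = density \<rho> (\<lambda>x. ennreal (D x))"
proof -
  have [measurable]: "D \<in> borel_measurable \<rho>" using D by auto
  have sp: "space \<rho> = space M" using assms(1) by (rule sets_eq_imp_space_eq)
  have intgr: "integrable \<rho> (\<lambda>x. indicator A x * D x)" if "A \<in> sets M" for A
    using D that assms(1) by (auto intro!: integrable_real_mult_indicator simp: mult.commute)
  have eq: "(SUP B\<in>{B \<in> sets M. B \<subseteq> A}. ennreal (\<sigma> B)) = emeasure (density \<rho> (\<lambda>x. ennreal (D x))) A"
    if A: "A \<in> sets M" for A
  proof -
    have A': "A \<in> sets \<rho>" using A assms(1) by simp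
    have em: "emeasure (density \<rho> (\<lambda>x. ennreal (D x))) A = (\<integral>\<^sup>+x. ennreal (D x) * indicator A x \<partial>\<rho>)"
      by (rule emeasure_density) (use A' in auto)
    show ?thesis
    proof (rule antisym)
      show "(SUP B\<in>{B \<in> sets M. B \<subseteq> A}. ennreal (\<sigma> B)) \<le> emeasure (density \<rho> (\<lambda>x. ennreal (D x))) A"
      proof (rule SUP_least)
        fix B assume B: "B \<in> {B \<in> sets M. B \<subseteq> A}"
        then have [measurable]: "B \<in> sets \<rho>" using assms(1) by simp
        have "ennreal (\<sigma> B) \<le> ennreal (\<integral>x. max 0 (indicator B x * D x) \<partial>\<rho>)"
          using B by (auto simp: \<sigma> intro!: ennreal_leI integral_mono intgr integrable_max)
        also have "\<dots> = (\<integral>\<^sup>+x. ennreal (max 0 (indicator B x * D x)) \<partial>\<rho>)"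
          using B by (intro nn_integral_eq_integral[symmetric] integrable_max intgr) auto
        also have "\<dots> \<le> (\<integral>\<^sup>+x. ennreal (D x) * indicator A x \<partial>\<rho>)"
          using B by (intro nn_integral_mono) (auto simp: indicator_def max_def ennreal_neg)
        finally show "ennreal (\<sigma> B) \<le> emeasure (density \<rho> (\<lambda>x. ennreal (D x))) A"
          unfolding em .
      qed
      define B where "B = {x \<in> space \<rho>. 0 < D x} \<inter> A"
      have "B \<in> sets \<rho>" unfolding B_def using A' by measurable
      then have B: "B \<in> sets M" "B \<subseteq> A" using assms(1) by (auto simp: B_def)
      have "(\<integral>\<^sup>+x. ennreal (D x) * indicator A x \<partial>\<rho>) = (\<integral>\<^sup>+x. ennreal (indicator B x * D x) \<partial>\<rho>)"
        by (intro nn_integral_cong) (auto simp: B_def indicator_def ennreal_neg)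
      also have "\<dots> = ennreal (\<sigma> B)"
        unfolding \<sigma>[OF B(1)] using B
        by (intro nn_integral_eq_integral intgr) (auto simp: B_def indicator_def)
      finally show "emeasure (density \<rho> (\<lambda>x. ennreal (D x))) A \<le> (SUP B\<in>{B \<in> sets M. B \<subseteq> A}. ennreal (\<sigma> B))"
        unfolding em using B by (auto intro!: SUP_upper)
    qed
  qed
  have "upper_variation M \<sigma> =
      measure_of (space M) (sets M) (emeasure (density \<rho> (\<lambda>x. ennreal (D x))))"
    unfolding upper_variation_def
    by (rule measure_of_eq) (auto simp: sets.space_closed sets.sigma_sets_eq eq)
  also have "\<dots> = density \<rho> (\<lambda>x. ennreal (D x))"
    using measure_of_of_measure[of "density \<rho> (\<lambda>x. ennreal (D x))"] assms(1) sp by simp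
  finally show ?thesis .
qed

text \<open>The images of the positive and the negative part of \<open>u\<close> need not be
  mutually singular, since \<open>\<phi>\<close> may bring masses of opposite sign together.
  Radon--Nikodym derivatives with respect to the image \<open>\<tau>\<close> of the absolute mass
  account for the cancellation: \<open>D1 - D2\<close> is a density of \<open>\<sigma>\<close>, and
  for densities the upper variation is known.\<close>

lemma integral_upper_variation_pushforward:
  fixes u :: "'b \<Rightarrow> real" and h :: "'a \<Rightarrow> complex"
  assumes u: "integrable P u" and \<phi>[measurable]: "\<phi> \<in> measurable P M"
    and \<sigma>: "\<And>A. A \<in> sets M \<Longrightarrow> \<sigma> A = (\<integral>x. indicator A (\<phi> x) * u x \<partial>P)"
    and h[measurable]: "h \<in> borel_measurable M" and bdd: "\<And>x. x \<in> space M \<Longrightarrow> cmod (h x) \<le> c"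
  shows "(LINT t|upper_variation M \<sigma>. h t) - (LINT t|upper_variation M (\<lambda>A. - \<sigma> A). h t)
     = (LINT x|P. h (\<phi> x) * of_real (u x))"
proof -
  have [measurable]: "u \<in> borel_measurable P" using u by auto
  define \<rho> where "\<rho> v = distr (density P (\<lambda>x. ennreal (v x))) M \<phi>" for v
  have sets_\<rho> [measurable_cong, simp]: "sets (\<rho> v) = sets M" for v by (simp add: \<rho>_def)
  have em_\<rho>: "emeasure (\<rho> v) A = (\<integral>\<^sup>+x. ennreal (v x) * indicator A (\<phi> x) \<partial>P)"
    if [measurable]: "A \<in> sets M" "v \<in> borel_measurable P" for A v
  proof -
    have "emeasure (\<rho> v) A = (\<integral>\<^sup>+x. ennreal (v x) * indicator (\<phi> -` A \<inter> space P) x \<partial>P)"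
      unfolding \<rho>_def by (subst emeasure_distr) (auto simp: emeasure_density)
    also have "\<dots> = (\<integral>\<^sup>+x. ennreal (v x) * indicator A (\<phi> x) \<partial>P)"
      by (intro nn_integral_cong) (auto simp: indicator_def)
    finally show ?thesis .
  qed
  have fin: "finite_measure (\<rho> v)" if v: "integrable P v" "\<And>x. 0 \<le> v x" for v
  proof
    have [measurable]: "v \<in> borel_measurable P" using v by auto
    have "emeasure (\<rho> v) (space M) \<le> (\<integral>\<^sup>+x. ennreal (v x) \<partial>P)"
      by (subst em_\<rho>) (auto intro!: nn_integral_mono simp: indicator_def)
    also have "\<dots> < \<infinity>" using v by (subst nn_integral_eq_integral) auto
    finally show "emeasure (\<rho> v) (space (\<rho> v)) \<noteq> \<infinity>" by (simp add: \<rho>_def)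
  qed
  have int_\<rho>: "integral\<^sup>L (\<rho> v) k = (LINT x|P. v x *\<^sub>R k (\<phi> x))"
    if [measurable]: "v \<in> borel_measurable P" "k \<in> borel_measurable M" and "\<And>x. 0 \<le> v x"
    for v and k :: "'a \<Rightarrow> 'c :: {banach, second_countable_topology}"
    unfolding \<rho>_def using that by (subst integral_distr) (auto simp: integral_density)
  define u1 where "u1 x = max 0 (u x)" for x
  define u2 where "u2 x = max 0 (- u x)" for x
  define \<tau> where "\<tau> = \<rho> (\<lambda>x. \<bar>u x\<bar>)"
  have u1: "integrable P u1" "\<And>x. 0 \<le> u1 x" "\<And>x. u1 x \<le> \<bar>u x\<bar>"
    and u2: "integrable P u2" "\<And>x. 0 \<le> u2 x" "\<And>x. u2 x \<le> \<bar>u x\<bar>"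
    and u12: "\<And>x. u x = u1 x - u2 x"
    unfolding u1_def u2_def using u by auto
  have sets_\<tau> [measurable_cong, simp]: "sets \<tau> = sets M" by (simp add: \<tau>_def)
  have space_\<tau>: "space \<tau> = space M" using sets_\<tau> by (rule sets_eq_imp_space_eq)
  have fin_\<tau>: "finite_measure \<tau>" unfolding \<tau>_def using u by (intro fin) auto
  interpret \<tau>: finite_measure \<tau> by (rule fin_\<tau>)
  have RN: "\<exists>D. D \<in> borel_measurable M \<and> (\<forall>x. 0 \<le> D x) \<and> integrable \<tau> D \<and> \<rho> v = density \<tau> (\<lambda>x. ennreal (D x))"
    if v: "integrable P v" "\<And>x. 0 \<le> v x" "\<And>x. v x \<le> \<bar>u x\<bar>" for v
  proof -
    have [measurable]: "v \<in> borel_measurable P" using v by auto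
    have le: "emeasure (\<rho> v) A \<le> emeasure \<tau> A" if "A \<in> sets M" for A
      unfolding \<tau>_def using that v(3)
      by (subst (1 2) em_\<rho>) (auto intro!: nn_integral_mono mult_right_mono ennreal_leI)
    have ac: "absolutely_continuous \<tau> (\<rho> v)"
      unfolding absolutely_continuous_def null_sets_def using le by fastforce
    have finv: "finite_measure (\<rho> v)" by (rule fin[OF v(1,2)])
    have sets_eq: "sets (\<rho> v) = sets \<tau>" by simp
    obtain D where D: "D \<in> borel_measurable \<tau>" "AE x in \<tau>. RN_deriv \<tau> (\<rho> v) x = ennreal (D x)" "\<And>x. 0 \<le> D x"
      using \<tau>.real_RN_deriv[OF finv ac sets_eq] by metis
    have [measurable]: "D \<in> borel_measurable M" using D(1) by measurable
    have "\<rho> v = density \<tau> (RN_deriv \<tau> (\<rho> v))"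
      using \<tau>.density_RN_deriv[OF ac sets_eq] by simp
    also have "\<dots> = density \<tau> (\<lambda>x. ennreal (D x))"
      by (rule density_cong) (use D in auto)
    finally have eq: "\<rho> v = density \<tau> (\<lambda>x. ennreal (D x))" .
    have "(\<integral>\<^sup>+x. ennreal (D x) \<partial>\<tau>) = emeasure (density \<tau> (\<lambda>x. ennreal (D x))) (space \<tau>)"
      using D by (subst emeasure_density) (auto intro!: nn_integral_cong simp: space_\<tau>)
    also have "\<dots> < \<infinity>"
      using finite_measure.emeasure_finite[OF finv] by (simp add: eq[symmetric] top.not_eq_extremum)
    finally have "integrable \<tau> D"
      by (intro integrableI_nonneg) (use D in auto)
    then show ?thesis using D eq by (intro exI[of _ D]) auto
  qed
  obtain D1 where D1 [measurable]: "D1 \<in> borel_measurable M" and D1': "\<And>x. 0 \<le> D1 x" "integrable \<tau> D1"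
    "\<rho> u1 = density \<tau> (\<lambda>x. ennreal (D1 x))" using RN[OF u1] by blast
  obtain D2 where D2 [measurable]: "D2 \<in> borel_measurable M" and D2': "\<And>x. 0 \<le> D2 x" "integrable \<tau> D2"
    "\<rho> u2 = density \<tau> (\<lambda>x. ennreal (D2 x))" using RN[OF u2] by blast
  have [measurable]: "u1 \<in> borel_measurable P" "u2 \<in> borel_measurable P" using u1 u2 by auto
  have transfer: "(LINT x|P. u1 x *\<^sub>R k (\<phi> x)) = (LINT t|\<tau>. D1 t *\<^sub>R k t)"
      "(LINT x|P. u2 x *\<^sub>R k (\<phi> x)) = (LINT t|\<tau>. D2 t *\<^sub>R k t)"
    if [measurable]: "k \<in> borel_measurable M" for k :: "'a \<Rightarrow> 'c :: {banach, second_countable_topology}"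
    using int_\<rho>[of u1 k] int_\<rho>[of u2 k] u1(2) u2(2) D1' D2' by (simp_all add: integral_density)
  have bint: "integrable P (\<lambda>x. v x *\<^sub>R k (\<phi> x))"
    if "integrable P v" and [measurable]: "k \<in> borel_measurable M" and "\<And>x. x \<in> space M \<Longrightarrow> norm (k x) \<le> c'"
    for v c' and k :: "'a \<Rightarrow> 'c :: {banach, second_countable_topology}"
  proof (rule Bochner_Integration.integrable_bound[of _ "\<lambda>x. c' * v x"])
    show "AE x in P. norm (v x *\<^sub>R k (\<phi> x)) \<le> norm (c' * v x)"
    proof (rule AE_I2)
      fix x assume "x \<in> space P"
      then have "norm (k (\<phi> x)) \<le> c'" using that(3) measurable_space[OF \<phi>] by blast
      then show "norm (v x *\<^sub>R k (\<phi> x)) \<le> norm (c' * v x)"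
        using mult_right_mono[of "norm (k (\<phi> x))" "\<bar>c'\<bar>" "\<bar>v x\<bar>"] by (simp add: abs_mult mult.commute)
    qed
  qed (use that in auto)
  have bint': "integrable \<tau> (\<lambda>x. v x *\<^sub>R k x)"
    if "integrable \<tau> v" and [measurable]: "k \<in> borel_measurable M" and "\<And>x. x \<in> space M \<Longrightarrow> norm (k x) \<le> c'"
    for v c' and k :: "'a \<Rightarrow> 'c :: {banach, second_countable_topology}"
  proof (rule Bochner_Integration.integrable_bound[of _ "\<lambda>x. c' * v x"])
    show "AE x in \<tau>. norm (v x *\<^sub>R k x) \<le> norm (c' * v x)"
    proof (rule AE_I2)
      fix x assume "x \<in> space \<tau>"
      then have "norm (k x) \<le> c'" using that(3) space_\<tau> by blast
      then show "norm (v x *\<^sub>R k x) \<le> norm (c' * v x)"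
        using mult_right_mono[of "norm (k x)" "\<bar>c'\<bar>" "\<bar>v x\<bar>"] by (simp add: abs_mult mult.commute)
    qed
  qed (use that in auto)
  define D where "D x = D1 x - D2 x" for x
  have D: "integrable \<tau> D" unfolding D_def using D1' D2' by auto
  have [measurable]: "D \<in> borel_measurable M" unfolding D_def by measurable
  have key: "(LINT x|P. u x *\<^sub>R k (\<phi> x)) = (LINT t|\<tau>. D t *\<^sub>R k t)"
    if [measurable]: "k \<in> borel_measurable M" and bk: "\<And>x. x \<in> space M \<Longrightarrow> norm (k x) \<le> c'"
    for c' and k :: "'a \<Rightarrow> 'c :: {banach, second_countable_topology}"
  proof -
    have "(LINT x|P. u x *\<^sub>R k (\<phi> x)) = (LINT x|P. u1 x *\<^sub>R k (\<phi> x)) - (LINT x|P. u2 x *\<^sub>R k (\<phi> x))"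
      unfolding u12 scaleR_diff_left
      by (rule Bochner_Integration.integral_diff) (use u1 u2 bk in \<open>auto intro!: bint\<close>)
    also have "\<dots> = (LINT t|\<tau>. D t *\<^sub>R k t)"
      unfolding transfer[OF that(1)] D_def scaleR_diff_left
      by (rule Bochner_Integration.integral_diff[symmetric]) (use D1' D2' bk in \<open>auto intro!: bint'\<close>)
    finally show ?thesis .
  qed
  have \<sigma>D: "\<sigma> A = (\<integral>t. indicator A t * D t \<partial>\<tau>)" if A: "A \<in> sets M" for A
  proof -
    have ind: "norm (indicator A x :: real) \<le> 1" for x by (simp add: indicator_def)
    have "\<sigma> A = (LINT x|P. u x *\<^sub>R indicator A (\<phi> x))"
      by (simp add: \<sigma> A mult.commute)
    also have "\<dots> = (LINT t|\<tau>. D t *\<^sub>R indicator A t)"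
      by (rule key[OF _ ind]) (use A in auto)
    finally show ?thesis by (simp add: mult.commute)
  qed
  have uv1: "upper_variation M \<sigma> = density \<tau> (\<lambda>x. ennreal (D x))"
    by (rule upper_variation_eq_density) (use \<sigma>D D in auto)
  have uv2: "upper_variation M (\<lambda>A. - \<sigma> A) = density \<tau> (\<lambda>x. ennreal (- D x))"
    by (rule upper_variation_eq_density) (use \<sigma>D D in auto)
  have pos: "density \<tau> (\<lambda>x. ennreal (w x)) = density \<tau> (\<lambda>x. ennreal (max 0 (w x)))" for w
    by (rule arg_cong[where f = "density \<tau>"]) (auto simp: fun_eq_iff max_def ennreal_neg)
  have "(LINT t|upper_variation M \<sigma>. h t) - (LINT t|upper_variation M (\<lambda>A. - \<sigma> A). h t)
     = (LINT t|\<tau>. max 0 (D t) *\<^sub>R h t) - (LINT t|\<tau>. max 0 (- D t) *\<^sub>R h t)"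
    unfolding uv1 uv2 pos[of D] pos[of "\<lambda>x. - D x"]
    by (subst (1 2) integral_density) auto
  also have "\<dots> = (LINT t|\<tau>. max 0 (D t) *\<^sub>R h t - max 0 (- D t) *\<^sub>R h t)"
    by (rule Bochner_Integration.integral_diff[symmetric]) (use D bdd in \<open>auto intro!: bint'\<close>)
  also have "\<dots> = (LINT t|\<tau>. D t *\<^sub>R h t)"
    by (intro Bochner_Integration.integral_cong) (auto simp: max_def)
  also have "\<dots> = (LINT x|P. h (\<phi> x) * of_real (u x))"
    by (subst key[OF h bdd, symmetric]) (use bdd in \<open>auto simp: scaleR_conv_of_real mult.commute\<close>)
  finally show ?thesis .
qed

lemma complex_measure_pushforward:
  fixes f :: "'b \<Rightarrow> complex"
  assumes f: "integrable P f" and \<phi>[measurable]: "\<phi> \<in> measurable P M"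
  shows "complex_measure M (\<lambda>A. \<integral>x. indicator A (\<phi> x) *\<^sub>R f x \<partial>P)"
  unfolding complex_measure_def
proof (intro allI impI)
  fix A :: "nat \<Rightarrow> 'a set" assume A: "range A \<subseteq> sets M" "disjoint_family A"
  have [measurable]: "A i \<in> sets M" for i using A by auto
  have [measurable]: "f \<in> borel_measurable P" using f by auto
  have intgr: "integrable P (\<lambda>x. indicator B (\<phi> x) *\<^sub>R f x)" if [measurable]: "B \<in> sets M" for B
    by (rule Bochner_Integration.integrable_bound[OF f]) (auto simp: indicator_def)
  have partial: "(\<Sum>i<n. \<integral>x. indicator (A i) (\<phi> x) *\<^sub>R f x \<partial>P)
      = (\<integral>x. indicator (\<Union>i<n. A i) (\<phi> x) *\<^sub>R f x \<partial>P)" for n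
  proof -
    have disj: "disjoint_family_on A {..<n}" using A(2) by (auto simp: disjoint_family_on_def)
    show ?thesis
      unfolding indicator_UN_disjoint[OF finite_lessThan disj] scaleR_sum_left
      by (rule Bochner_Integration.integral_sum[symmetric]) (simp add: intgr)
  qed
  show "(\<lambda>n. \<integral>x. indicator (A n) (\<phi> x) *\<^sub>R f x \<partial>P) sums (\<integral>x. indicator (\<Union>n. A n) (\<phi> x) *\<^sub>R f x \<partial>P)"
    unfolding sums_def partial
  proof (rule integral_dominated_convergence[where w = "\<lambda>x. norm (f x)"])
    show "AE x in P. (\<lambda>n. indicator (\<Union>i<n. A i) (\<phi> x) *\<^sub>R f x) \<longlonglongrightarrow> indicator (\<Union>n. A n) (\<phi> x) *\<^sub>R f x"
      by (intro AE_I2 tendsto_scaleR LIMSEQ_indicator_UN tendsto_const)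
    show "AE x in P. norm (indicator (\<Union>i<n. A i) (\<phi> x) *\<^sub>R f x) \<le> norm (f x)" for n
      by (auto simp: indicator_def)
  qed (use f in \<open>auto intro!: borel_measurable_integrable intgr\<close>)
qed

lemma complex_measure_integral_pushforward:
  fixes f :: "'b \<Rightarrow> complex" and h :: "'a \<Rightarrow> complex"
  assumes f: "integrable P f" and \<phi>[measurable]: "\<phi> \<in> measurable P M"
    and h[measurable]: "h \<in> borel_measurable M" and bdd: "\<And>x. x \<in> space M \<Longrightarrow> cmod (h x) \<le> c"
  shows "complex_measure_integral M (\<lambda>A. \<integral>x. indicator A (\<phi> x) *\<^sub>R f x \<partial>P) h = (\<integral>x. h (\<phi> x) * f x \<partial>P)"
proof -
  have [measurable]: "f \<in> borel_measurable P" using f by auto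
  have intgr: "integrable P (\<lambda>x. indicator B (\<phi> x) *\<^sub>R f x)" if [measurable]: "B \<in> sets M" for B
    by (rule Bochner_Integration.integrable_bound[OF f]) (auto simp: indicator_def)
  have hint: "integrable P (\<lambda>x. h (\<phi> x) * of_real (v x))" if "integrable P v" for v
  proof (rule Bochner_Integration.integrable_bound[of _ "\<lambda>x. c * v x"])
    show "AE x in P. norm (h (\<phi> x) * of_real (v x)) \<le> norm (c * v x)"
    proof (rule AE_I2)
      fix x assume "x \<in> space P"
      then have "norm (h (\<phi> x)) \<le> \<bar>c\<bar>" using bdd measurable_space[OF \<phi>] abs_ge_self[of c] by fastforce
      then show "norm (h (\<phi> x) * of_real (v x)) \<le> norm (c * v x)"
        by (simp add: norm_mult abs_mult mult_right_mono)
    qed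
  qed (use that in auto)
  have Re: "Re (\<integral>x. indicator A (\<phi> x) *\<^sub>R f x \<partial>P) = (\<integral>x. indicator A (\<phi> x) * Re (f x) \<partial>P)"
    and Im: "Im (\<integral>x. indicator A (\<phi> x) *\<^sub>R f x \<partial>P) = (\<integral>x. indicator A (\<phi> x) * Im (f x) \<partial>P)"
    if "A \<in> sets M" for A
    using intgr[OF that] by (simp_all flip: integral_Re integral_Im)
  have "complex_measure_integral M (\<lambda>A. \<integral>x. indicator A (\<phi> x) *\<^sub>R f x \<partial>P) h
      = (\<integral>x. h (\<phi> x) * of_real (Re (f x)) \<partial>P) + \<i> * (\<integral>x. h (\<phi> x) * of_real (Im (f x)) \<partial>P)"
    unfolding complex_measure_integral_def
    using f Re Im bdd
    by (subst (1 2) integral_upper_variation_pushforward[where P = P and \<phi> = \<phi> and c = c]) auto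
  also have "\<dots> = (\<integral>x. h (\<phi> x) * of_real (Re (f x)) + \<i> * (h (\<phi> x) * of_real (Im (f x))) \<partial>P)"
    using f by (subst Bochner_Integration.integral_add) (auto intro!: hint)
  also have "\<dots> = (\<integral>x. h (\<phi> x) * f x \<partial>P)"
    by (intro Bochner_Integration.integral_cong refl)
       (metis complex_eq distrib_left mult.left_commute)
  finally show ?thesis .
qed

section \<open>Size and regularity of the kernel, and membership in the family F\<close>

lemma norm_one_diff_cnj_ge:
  assumes "cmod \<zeta> \<le> 1"
  shows "1 - cmod z \<le> cmod (1 - cnj \<zeta> * z)"
proof -
  have "cmod (cnj \<zeta> * z) \<le> cmod z" using assms by (simp add: norm_mult mult_left_le_one_le)
  then show ?thesis using norm_triangle_ineq2[of 1 "cnj \<zeta> * z"] by simp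
qed

lemma kernel_not_nonpos:
  assumes "cmod w < 1"
  shows "1 - w \<notin> \<real>\<^sub>\<le>\<^sub>0"
proof
  assume "1 - w \<in> \<real>\<^sub>\<le>\<^sub>0"
  then have "Re w \<ge> 1" by (auto simp: complex_nonpos_Reals_iff)
  then show False using complex_Re_le_cmod[of w] assms by linarith
qed

lemma kernel_not_nonpos':
  assumes "cmod \<zeta> \<le> 1" "cmod z < 1"
  shows "1 - cnj \<zeta> * z \<notin> \<real>\<^sub>\<le>\<^sub>0"
  using assms mult_left_le_one_le[of "cmod z" "cmod \<zeta>"]
  by (intro kernel_not_nonpos) (simp add: norm_mult)

lemma cmod_powr_of_real: "cmod (w powr of_real \<alpha>) = cmod w powr \<alpha>"
  by (cases "w = 0") (simp_all add: norm_powr_real_powr')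

lemma kernel_measurable:
  assumes "cmod z < 1"
  shows "(\<lambda>\<zeta>. 1 / (1 - cnj \<zeta> * z) powr of_real \<alpha>) \<in> borel_measurable circle_borel"
proof (rule borel_measurable_continuous_on_restrict, intro continuous_on_divide continuous_on_powr_complex)
  have pos: "Re (1 - cnj \<zeta> * z) > 0" if "\<zeta> \<in> sphere 0 1" for \<zeta>
    using that assms complex_Re_le_cmod[of "cnj \<zeta> * z"] by (simp add: norm_mult)
  show "sphere 0 1 \<subseteq> {\<zeta>. 0 \<le> Re (1 - cnj \<zeta> * z) \<or> Im (1 - cnj \<zeta> * z) \<noteq> 0}"
    using pos less_imp_le by blast
  show "0 < Re (of_real \<alpha>)" if "\<zeta> \<in> sphere 0 1" "1 - cnj \<zeta> * z = 0" for \<zeta>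
    using pos[OF that(1)] that(2) by simp
  show "\<forall>\<zeta>\<in>sphere 0 1. (1 - cnj \<zeta> * z) powr of_real \<alpha> \<noteq> 0"
    using pos by fastforce
qed (auto intro!: continuous_intros)

lemma kernel_bound:
  assumes "cmod z < 1" "\<alpha> \<ge> 0" "cmod \<zeta> \<le> 1"
  shows "cmod (1 / (1 - cnj \<zeta> * z) powr of_real \<alpha>) \<le> 1 / (1 - cmod z) powr \<alpha>"
  using assms norm_one_diff_cnj_ge[of \<zeta> z]
  by (auto simp: norm_divide cmod_powr_of_real intro!: divide_left_mono powr_mono2 mult_pos_pos)

text \<open>With \<open>P\<close> arbitrary, a single integrable function on a product space can
  gather countably many densities and atoms into one measure on the circle.\<close>

lemma F_space_pushforward:
  fixes f :: "'b \<Rightarrow> complex"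
  assumes "\<alpha> > 0" and f: "integrable P f" and \<phi>: "\<phi> \<in> borel_measurable P" "\<And>x. cmod (\<phi> x) = 1"
    and g: "\<And>z. cmod z < 1 \<Longrightarrow> g z = (\<integral>x. 1 / (1 - cnj (\<phi> x) * z) powr of_real \<alpha> * f x \<partial>P)"
  shows "g \<in> F_space \<alpha>"
proof -
  have \<phi>': "\<phi> \<in> measurable P circle_borel"
    using \<phi> by (intro measurable_restrict_space2) auto
  show ?thesis
    unfolding F_space_def
    using assms complex_measure_pushforward[OF f \<phi>']
      complex_measure_integral_pushforward[OF f \<phi>' kernel_measurable kernel_bound]
    by (intro CollectI exI[of _ "\<lambda>A. \<integral>x. indicator A (\<phi> x) *\<^sub>R f x \<partial>P"]) (auto simp: space_restrict_space)
qed

section \<open>Newman--Carleson sequences in a Stoltz angle\<close>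

lemma cmod_power2_diff:
  "(cmod (1 - cnj z * w))\<^sup>2 - (cmod (z - w))\<^sup>2 = (1 - (cmod z)\<^sup>2) * (1 - (cmod w)\<^sup>2)"
  by (simp add: cmod_power2) (simp add: power2_eq_square algebra_simps)

text \<open>Both arguments lie strictly between \<open>- pi / 2\<close> and \<open>pi / 2\<close>,
  so their difference stays within the principal branch.\<close>

lemma powr_divide_right_half_plane:
  fixes x y :: complex
  assumes "Re x > 0" "Re y > 0"
  shows "x powr s / y powr s = (x / y) powr s"
proof -
  have ne: "x \<noteq> 0" "y \<noteq> 0" and y: "y \<notin> \<real>\<^sub>\<le>\<^sub>0" using assms by (auto simp: complex_nonpos_Reals_iff)
  have b: "\<bar>Im (Ln x)\<bar> < pi / 2" "\<bar>Im (Ln y)\<bar> < pi / 2"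
    using Re_Ln_pos_lt ne assms by auto
  have "Ln (x * inverse y) = Ln x + Ln (inverse y)"
    using ne b Ln_inverse[OF y] by (intro Ln_times_simple) auto
  then have "Ln (x / y) = Ln x - Ln y"
    by (simp add: Ln_inverse[OF y] divide_inverse)
  then show ?thesis
    using ne by (simp add: powr_def exp_diff right_diff_distrib)
qed

lemma cmod_exp_minus_one_le: "cmod (exp z - 1) \<le> cmod z * exp (cmod z)"
proof -
  have "cmod (exp z - exp 0) \<le> exp (cmod z) * cmod (z - 0)"
  proof (rule field_differentiable_bound[of "cball 0 (cmod z)" exp exp])
    show "cmod (exp w) \<le> exp (cmod z)" if "w \<in> cball 0 (cmod z)" for w
      using that complex_Re_le_cmod[of w] by simp
  qed (auto intro!: derivative_eq_intros)
  then show ?thesis by (simp add: mult.commute)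
qed

text \<open>Near 1 the power is \<open>exp (\<alpha> * Ln w)\<close> with \<open>Ln w\<close> of the
  size of \<open>w - 1\<close>. At distance at least 1/2 from 1 the left side is merely bounded, and
  there the jump across the branch cut does no harm.\<close>

lemma powr_minus_one_bound:
  assumes "\<alpha> \<ge> 0" "R \<ge> 0"
  shows "\<exists>B\<ge>0. \<forall>w. cmod w \<le> R \<longrightarrow> cmod (w powr of_real \<alpha> - 1) \<le> B * cmod (w - 1)"
proof (intro exI conjI allI impI)
  define B where "B = 2 * \<alpha> * exp \<alpha> + 2 * (R powr \<alpha> + 1)"
  show "B \<ge> 0" using assms by (simp add: B_def add_nonneg_nonneg)
  fix w assume w: "cmod w \<le> R"
  show "cmod (w powr of_real \<alpha> - 1) \<le> B * cmod (w - 1)"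
  proof (cases "cmod (w - 1) < 1/2")
    case True
    then have "w \<noteq> 0" by auto
    have ln: "cmod (Ln w) \<le> 2 * cmod (w - 1)"
      using norm_Ln_le[OF True] by simp
    have "cmod (of_real \<alpha> * Ln w) \<le> \<alpha> * (2 * cmod (w - 1))"
      using ln assms by (simp add: norm_mult mult_left_mono)
    moreover from this have "cmod (of_real \<alpha> * Ln w) \<le> \<alpha>"
      using True assms mult_left_mono[of "2 * cmod (w - 1)" 1 \<alpha>] by linarith
    ultimately have "cmod (exp (of_real \<alpha> * Ln w) - 1) \<le> \<alpha> * (2 * cmod (w - 1)) * exp \<alpha>"
      using assms
      by (intro order_trans[OF cmod_exp_minus_one_le] mult_mono) auto
    also have "\<dots> \<le> B * cmod (w - 1)"
      using assms by (simp add: B_def algebra_simps)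
    finally show ?thesis using \<open>w \<noteq> 0\<close> by (simp add: powr_def)
  next
    case False
    have "cmod (w powr of_real \<alpha> - 1) \<le> cmod w powr \<alpha> + 1"
      using norm_triangle_ineq4[of "w powr of_real \<alpha>" 1] by (simp add: cmod_powr_of_real)
    also have "\<dots> \<le> R powr \<alpha> + 1" using w assms by (simp add: powr_mono2)
    also have "\<dots> \<le> 2 * (R powr \<alpha> + 1) * cmod (w - 1)"
    proof -
      have "(R powr \<alpha> + 1) * 1 \<le> (R powr \<alpha> + 1) * (2 * cmod (w - 1))"
        using False by (intro mult_left_mono) (auto simp: add_nonneg_nonneg)
      then show ?thesis by (simp add: algebra_simps)
    qed
    also have "\<dots> \<le> B * cmod (w - 1)"
      using assms by (intro mult_right_mono) (auto simp: B_def)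
    finally show ?thesis .
  qed
qed

lemma sum_power_below_le:
  fixes r :: real
  assumes "0 \<le> r" "r < 1"
  shows "(\<Sum>k<n. r ^ (n - 1 - k)) \<le> 1 / (1 - r)" "(\<Sum>k<n. r ^ k) \<le> 1 / (1 - r)"
proof -
  show *: "(\<Sum>k<n. r ^ k) \<le> 1 / (1 - r)"
    using assms sum_le_suminf[of "\<lambda>k. r ^ k" "{..<n}"] by (simp add: suminf_geometric summable_geometric)
  show "(\<Sum>k<n. r ^ (n - 1 - k)) \<le> 1 / (1 - r)"
    using * sum.nat_diff_reindex[of "\<lambda>k. r ^ k" n] by simp
qed

lemma sum_power_above_le:
  fixes r :: real
  assumes "0 \<le> r" "r < 1"
  shows "(\<Sum>k\<in>{n..<N}. r ^ (k - n)) \<le> 1 / (1 - r)"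
proof -
  have "(\<Sum>k\<in>{n..<N}. r ^ (k - n)) = (\<Sum>k<N - n. r ^ k)"
    by (rule sum.reindex_bij_witness[of _ "\<lambda>k. k + n" "\<lambda>k. k - n"]) auto
  then show ?thesis using sum_power_below_le(2)[OF assms] by simp
qed

text \<open>The tail sums satisfy \<open>S n \<le> C * (S n - S (Suc n))\<close>, so each is at most
  \<open>1 - 1 / C\<close> times the previous one.\<close>

lemma summable_tail_geometric:
  fixes d :: "nat \<Rightarrow> real"
  assumes pos: "\<And>n. 0 \<le> d n" and C: "C > 1" and tail: "\<And>n N. (\<Sum>k\<in>{n..<N}. d k) \<le> C * d n"
  shows "d (n + m) \<le> C * (1 - 1 / C) ^ m * d n"
proof -
  have sm: "summable d"
    using tail[of 0] pos by (intro summableI_nonneg_bounded[of d "C * d 0"]) (auto simp: lessThan_atLeast0)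
  define S where "S n = (\<Sum>k. d (k + n))" for n
  have sm': "summable (\<lambda>k. d (k + n))" for n using sm by (simp add: summable_iff_shift)
  have S_le: "S n \<le> C * d n" for n
    unfolding S_def
  proof (rule suminf_le_const[OF sm'])
    fix N
    have "(\<Sum>k<N. d (k + n)) = (\<Sum>k\<in>{n..<N + n}. d k)"
      by (rule sum.reindex_bij_witness[of _ "\<lambda>k. k - n" "\<lambda>k. k + n"]) auto
    then show "(\<Sum>k<N. d (k + n)) \<le> C * d n" using tail by simp
  qed
  have split: "S n = d n + S (Suc n)" for n
    using suminf_split_head[OF sm'[of n]] by (simp add: S_def)
  have step: "S (Suc n) \<le> (1 - 1 / C) * S n" for n
    using S_le[of n] split[of n] C by (simp add: field_simps)
  have "S (n + m) \<le> (1 - 1 / C) ^ m * S n"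
  proof (induction m)
    case (Suc m)
    have "S (n + Suc m) \<le> (1 - 1 / C) * S (n + m)" using step[of "n + m"] by simp
    also have "\<dots> \<le> (1 - 1 / C) * ((1 - 1 / C) ^ m * S n)"
      using Suc C by (intro mult_left_mono) auto
    finally show ?case by (simp add: algebra_simps)
  qed simp
  moreover have "d (n + m) \<le> S (n + m)"
    using split[of "n + m"] suminf_nonneg[OF sm'[of "Suc (n + m)"]] pos by (simp add: S_def)
  moreover have "(1 - 1 / C) ^ m * S n \<le> (1 - 1 / C) ^ m * (C * d n)"
    using S_le C by (intro mult_left_mono zero_le_power) auto
  ultimately show ?thesis by (simp add: algebra_simps)
qed

section \<open>Geometric decay of the distances to the circle\<close>

locale nc_stoltz =
  fixes a :: "nat \<Rightarrow> complex" and C \<delta> \<alpha> :: real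
  assumes \<alpha>: "\<alpha> > 0"
    and disc: "\<And>k. cmod (a k) < 1"
    and cmod_mono: "\<And>i j. i \<le> j \<Longrightarrow> cmod (a i) \<le> cmod (a j)"
    and stolz: "\<And>k. cmod (1 - a k) \<le> C * (1 - cmod (a k))"
    and \<delta>: "\<delta> > 0"
    and nc: "\<And>n N. \<delta> \<le> (\<Prod>k\<in>{..<N} - {n}. cmod ((a k - a n) / (1 - cnj (a k) * a n)))"
begin

definition d where "d k = 1 - cmod (a k)"

lemma d_pos: "d k > 0" and d_le_1: "d k \<le> 1"
  using disc[of k] by (auto simp: d_def)

lemma d_antimono: "i \<le> j \<Longrightarrow> d j \<le> d i"
  using cmod_mono by (simp add: d_def)

lemma stolz_d: "cmod (1 - a k) \<le> C * d k"
  using stolz by (simp add: d_def)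

lemma d_le: "d k \<le> cmod (1 - a k)"
  using norm_triangle_ineq2[of 1 "a k"] by (simp add: d_def)

lemma C_ge_1: "C \<ge> 1"
  using order_trans[OF d_le stolz_d[of 0]] d_pos[of 0] by simp

lemma denominator_ge: "d k \<le> cmod (1 - cnj (a k) * a n)" "d n \<le> cmod (1 - cnj (a k) * a n)"
proof -
  have "cmod (a k) * cmod (a n) \<le> cmod (a k) * 1" "cmod (a k) * cmod (a n) \<le> 1 * cmod (a n)"
    using disc[of n] disc[of k] by (intro mult_left_mono mult_right_mono; simp)+
  then show "d k \<le> cmod (1 - cnj (a k) * a n)" "d n \<le> cmod (1 - cnj (a k) * a n)"
    using norm_triangle_ineq2[of 1 "cnj (a k) * a n"] by (auto simp: d_def norm_mult)
qed

text \<open>Each of the two points lies within \<open>C\<close> times its distance to the circle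
  from 1. Together with \<open>denominator_ge\<close> this determines the denominator up to
  constants as \<open>max (d k) (d n)\<close>.\<close>

lemma denominator_le: "cmod (1 - cnj (a k) * a n) \<le> C * (d k + d n)"
proof -
  have "1 - cnj (a k) * a n = (1 - a n) + a n * cnj (1 - a k)" by (simp add: algebra_simps)
  then have "cmod (1 - cnj (a k) * a n) \<le> cmod (1 - a n) + cmod (a n) * cmod (1 - a k)"
    by (metis complex_mod_cnj norm_mult norm_triangle_ineq)
  also have "\<dots> \<le> C * d n + 1 * (C * d k)"
    using disc[of n] by (intro add_mono mult_mono stolz_d) auto
  finally show ?thesis by (simp add: algebra_simps)
qed

definition \<rho> where "\<rho> k n = cmod ((a k - a n) / (1 - cnj (a k) * a n))"

lemma one_minus_\<rho>_square:
  "1 - (\<rho> k n)\<^sup>2 = (1 - (cmod (a k))\<^sup>2) * (1 - (cmod (a n))\<^sup>2) / (cmod (1 - cnj (a k) * a n))\<^sup>2"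
proof -
  have "cmod (1 - cnj (a k) * a n) > 0" using denominator_ge(1)[of k n] d_pos[of k] by linarith
  then show ?thesis
    unfolding cmod_power2_diff[symmetric] by (simp add: \<rho>_def norm_divide power_divide field_simps)
qed

lemma \<rho>_le_1: "\<rho> k n \<le> 1"
proof -
  have "(cmod (a k))\<^sup>2 \<le> 1" "(cmod (a n))\<^sup>2 \<le> 1"
    using disc[of k] disc[of n] by (auto intro!: power_le_one)
  then have "1 - (\<rho> k n)\<^sup>2 \<ge> 0" unfolding one_minus_\<rho>_square by (intro divide_nonneg_nonneg mult_nonneg_nonneg) auto
  then show ?thesis using abs_square_le_1[of "\<rho> k n"] by (simp add: abs_le_iff)
qed

lemma \<rho>_nonneg: "\<rho> k n \<ge> 0" by (simp add: \<rho>_def)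

lemma \<rho>_ge: "k \<noteq> n \<Longrightarrow> \<delta> \<le> \<rho> k n"
proof -
  assume "k \<noteq> n"
  then have "(\<Prod>j\<in>{..<Suc k} - {n}. \<rho> j n) = \<rho> k n * (\<Prod>j\<in>{..<Suc k} - {n} - {k}. \<rho> j n)"
    by (intro prod.remove) auto
  also have "\<dots> \<le> \<rho> k n * 1"
    using \<rho>_le_1 \<rho>_nonneg by (intro mult_left_mono prod_le_1) auto
  finally show ?thesis using nc[of n "Suc k"] by (simp add: \<rho>_def)
qed

lemma separation:
  assumes "k \<noteq> n"
  shows "\<delta> * max (d k) (d n) \<le> cmod (a k - a n)"
proof -
  have pos: "cmod (1 - cnj (a k) * a n) > 0" using denominator_ge(1)[of k n] d_pos[of k] by linarith
  have "\<delta> * max (d k) (d n) \<le> \<delta> * cmod (1 - cnj (a k) * a n)"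
    using \<delta> denominator_ge by (intro mult_left_mono) auto
  also have "\<dots> \<le> cmod (a k - a n)"
    using \<rho>_ge[OF assms] pos by (simp add: \<rho>_def norm_divide field_simps)
  finally show ?thesis .
qed

text \<open>The inequality \<open>x \<le> exp (x - 1)\<close> turns the product into a sum. Squares
  are taken because \<open>1 - \<rho>^2\<close> has a closed form.\<close>

lemma sum_one_minus_\<rho>_square: "(\<Sum>k\<in>{..<N} - {n}. 1 - (\<rho> k n)\<^sup>2) \<le> - ln (\<delta>\<^sup>2)"
proof -
  have "\<delta>\<^sup>2 \<le> (\<Prod>k\<in>{..<N} - {n}. \<rho> k n)\<^sup>2"
    using nc[of n N] \<delta> by (intro power_mono) (auto simp: \<rho>_def)
  also have "\<dots> = (\<Prod>k\<in>{..<N} - {n}. (\<rho> k n)\<^sup>2)" by (rule prod_power_distrib)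
  also have "\<dots> \<le> (\<Prod>k\<in>{..<N} - {n}. exp (- (1 - (\<rho> k n)\<^sup>2)))"
  proof (rule prod_mono)
    fix k
    show "0 \<le> (\<rho> k n)\<^sup>2 \<and> (\<rho> k n)\<^sup>2 \<le> exp (- (1 - (\<rho> k n)\<^sup>2))"
      using exp_ge_add_one_self[of "- (1 - (\<rho> k n)\<^sup>2)"] by simp
  qed
  also have "\<dots> = exp (- (\<Sum>k\<in>{..<N} - {n}. 1 - (\<rho> k n)\<^sup>2))"
    by (simp only: exp_sum[symmetric] finite_Diff finite_lessThan sum_negf)
  finally have "ln (\<delta>\<^sup>2) \<le> - (\<Sum>k\<in>{..<N} - {n}. 1 - (\<rho> k n)\<^sup>2)"
    using \<delta> ln_le_cancel_iff[of "\<delta>\<^sup>2"] by (metis exp_gt_zero ln_exp zero_less_power)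
  then show ?thesis by simp
qed

text \<open>For \<open>k > n\<close> the quantity \<open>1 - \<rho>^2\<close> is at least
  \<open>d k / (4 * C^2 * d n)\<close>, so its bounded sums bound every tail of \<open>d\<close> by
  a multiple of the first term.\<close>

lemma d_geometric: "\<exists>K q. 1 \<le> K \<and> 0 < q \<and> q < 1 \<and> (\<forall>n m. d (n + m) \<le> K * q ^ m * d n)"
proof -
  define L where "L = - ln (\<delta>\<^sup>2)"
  have "L \<ge> 0" using sum_one_minus_\<rho>_square[of 0 0] by (simp add: L_def)
  \<comment> \<open>One unit of the 2 covers the term \<open>k = n\<close>; the other keeps
    \<open>K\<close> above 1 when \<open>L\<close> is 0.\<close>
  define K where "K = 2 + 4 * C\<^sup>2 * L"
  have K: "K > 1" using \<open>L \<ge> 0\<close> by (simp add: K_def add_pos_nonneg)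
  have d_le_\<rho>: "d k \<le> 4 * C\<^sup>2 * d n * (1 - (\<rho> k n)\<^sup>2)" if "n < k" for k n
  proof -
    have dd: "d k \<le> d n" using that by (intro d_antimono) auto
    have pos: "cmod (1 - cnj (a k) * a n) > 0" using denominator_ge(1)[of k n] d_pos[of k] by linarith
    have "d k \<le> 1 - (cmod (a k))\<^sup>2" "d n \<le> 1 - (cmod (a n))\<^sup>2"
      using disc[of k] disc[of n] by (auto simp: d_def power2_eq_square mult_left_le)
    then have "d k * d n \<le> (1 - (cmod (a k))\<^sup>2) * (1 - (cmod (a n))\<^sup>2)"
      using d_pos[of k] d_pos[of n] by (intro mult_mono) auto
    also have "\<dots> = (1 - (\<rho> k n)\<^sup>2) * (cmod (1 - cnj (a k) * a n))\<^sup>2"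
      unfolding one_minus_\<rho>_square using pos by simp
    also have "\<dots> \<le> (1 - (\<rho> k n)\<^sup>2) * (C * (2 * d n))\<^sup>2"
    proof (intro mult_left_mono power_mono)
      have "C * (d k + d n) \<le> C * (2 * d n)" using dd C_ge_1 by (intro mult_left_mono) auto
      then show "cmod (1 - cnj (a k) * a n) \<le> C * (2 * d n)" using denominator_le[of k n] by linarith
      show "0 \<le> 1 - (\<rho> k n)\<^sup>2" using \<rho>_le_1 \<rho>_nonneg by (simp add: power_le_one)
    qed auto
    also have "\<dots> = (4 * C\<^sup>2 * d n * (1 - (\<rho> k n)\<^sup>2)) * d n"
      by (simp add: power2_eq_square algebra_simps)
    finally show ?thesis using d_pos[of n] by (rule mult_right_le_imp_le)
  qed
  have tail: "(\<Sum>k\<in>{n..<N}. d k) \<le> K * d n" for n N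
  proof (cases "n < N")
    case True
    then have "(\<Sum>k\<in>{n..<N}. d k) = d n + (\<Sum>k\<in>{Suc n..<N}. d k)" by (rule sum.atLeast_Suc_lessThan)
    also have "(\<Sum>k\<in>{Suc n..<N}. d k) \<le> (\<Sum>k\<in>{Suc n..<N}. 4 * C\<^sup>2 * d n * (1 - (\<rho> k n)\<^sup>2))"
      by (intro sum_mono d_le_\<rho>) auto
    also have "\<dots> \<le> (\<Sum>k\<in>{..<N} - {n}. 4 * C\<^sup>2 * d n * (1 - (\<rho> k n)\<^sup>2))"
      using \<rho>_le_1 \<rho>_nonneg d_pos[of n] less_imp_le
      by (intro sum_mono2) (auto intro!: mult_nonneg_nonneg simp: power_le_one)
    also have "\<dots> \<le> 4 * C\<^sup>2 * d n * L"
      unfolding L_def sum_distrib_left[symmetric] using d_pos[of n]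
      by (intro mult_left_mono sum_one_minus_\<rho>_square) auto
    also have "d n + 4 * C\<^sup>2 * d n * L \<le> K * d n" using d_pos[of n] by (simp add: K_def algebra_simps)
    finally show ?thesis by simp
  qed (use K d_pos[of n] in auto)
  have "d (n + m) \<le> K * (1 - 1 / K) ^ m * d n" for n m
    by (rule summable_tail_geometric) (use K tail d_pos in \<open>auto simp: less_imp_le\<close>)
  then show ?thesis using K by (intro exI[of _ K] exI[of _ "1 - 1 / K"]) auto
qed

section \<open>The normalised kernels as approximate step functions, and part a)\<close>

definition \<Phi> where "\<Phi> \<zeta> k = (1 - a k) powr of_real \<alpha> * (1 / (1 - cnj \<zeta> * a k) powr of_real \<alpha>)"

lemma Re_one_minus_pos: "cmod w < 1 \<Longrightarrow> Re (1 - w) > 0"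
  using complex_Re_le_cmod[of w] by simp

text \<open>The definition is the product that appears under the integral; the estimates need the
  power of one quotient, whose numerator and denominator lie in the right half-plane.\<close>

lemma \<Phi>_eq: "cmod \<zeta> \<le> 1 \<Longrightarrow> \<Phi> \<zeta> k = ((1 - a k) / (1 - cnj \<zeta> * a k)) powr of_real \<alpha>"
proof -
  assume "cmod \<zeta> \<le> 1"
  then have "cmod (cnj \<zeta> * a k) < 1"
    using disc[of k] mult_left_le_one_le[of "cmod (a k)" "cmod \<zeta>"] by (simp add: norm_mult)
  then show ?thesis
    using powr_divide_right_half_plane[OF Re_one_minus_pos[OF disc] Re_one_minus_pos]
    by (simp add: \<Phi>_def)
qed

lemma \<Phi>_one: "\<Phi> 1 k = 1"
  using disc[of k] by (cases "a k = 1") (simp_all add: \<Phi>_def)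

text \<open>With \<open>t = cmod (1 - \<zeta>)\<close>, the quotient \<open>w k\<close> under the
  power differs from 1 by at most \<open>t / d k\<close> and is at most a multiple of
  \<open>d k / t\<close>. On either side of the crossing index \<open>n\<close> the geometric decay
  of \<open>d\<close> makes the matching bound summable. Both conditions on \<open>n\<close> are
  non-strict, so an index where \<open>d\<close> equals \<open>t\<close> may lie on either side;
  part b) exploits this.\<close>

lemma kernel_sums:
  "\<exists>B. \<forall>\<zeta> n N. cmod \<zeta> = 1 \<longrightarrow> (\<forall>k<n. cmod (1 - \<zeta>) \<le> d k) \<longrightarrow> (\<forall>k\<ge>n. d k \<le> cmod (1 - \<zeta>)) \<longrightarrow>
     (\<Sum>k<N. cmod (\<Phi> \<zeta> k - (if k < n then 1 else 0))) \<le> B"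
proof -
  obtain K q where K: "1 \<le> K" and q: "0 < q" "q < 1" and geo: "\<And>n m. d (n + m) \<le> K * q ^ m * d n"
    using d_geometric by blast
  obtain B1 where B1: "B1 \<ge> 0" "\<And>w. cmod w \<le> C \<Longrightarrow> cmod (w powr of_real \<alpha> - 1) \<le> B1 * cmod (w - 1)"
    using powr_minus_one_bound[of \<alpha> C] \<alpha> C_ge_1 by auto
  define q' where "q' = q powr \<alpha>"
  have q': "0 < q'" "q' < 1" using q \<alpha> by (auto simp: q'_def powr_def mult_pos_neg)
  define B2 where "B2 = (C * (1 + C) * K) powr \<alpha>"
  show ?thesis
  proof (intro exI allI impI)
    fix \<zeta> n N
    assume \<zeta>: "cmod \<zeta> = 1" and lo: "\<forall>k<n. cmod (1 - \<zeta>) \<le> d k" and hi: "\<forall>k\<ge>n. d k \<le> cmod (1 - \<zeta>)"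
    define t where "t = cmod (1 - \<zeta>)"
    have t: "t > 0" using hi d_pos[of n] by (auto simp: t_def intro: less_le_trans)
    have t': "cmod (1 - cnj \<zeta>) = t" unfolding t_def by (metis complex_cnj_diff complex_cnj_one complex_mod_cnj)
    define w where "w k = (1 - a k) / (1 - cnj \<zeta> * a k)" for k
    have \<Phi>w: "\<Phi> \<zeta> k = w k powr of_real \<alpha>" for k using \<Phi>_eq \<zeta> by (simp add: w_def)
    have den: "d k \<le> cmod (1 - cnj \<zeta> * a k)" for k
      using norm_one_diff_cnj_ge[of \<zeta> "a k"] \<zeta> by (simp add: d_def)
    have den_pos: "cmod (1 - cnj \<zeta> * a k) > 0" for k using den[of k] d_pos[of k] by linarith
    have num: "cmod (1 - a k) \<le> C * cmod (1 - cnj \<zeta> * a k)" for k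
      using stolz_d[of k] mult_left_mono[OF den[of k], of C] C_ge_1 by linarith
    have den_t: "t \<le> (1 + C) * cmod (1 - cnj \<zeta> * a k)" for k
    proof -
      \<comment> \<open>Moving from 1 to \<open>a k\<close> changes the denominator by
        \<open>1 - a k\<close> in modulus, which the Stolz condition bounds by a multiple of the
        denominator itself.\<close>
      have "1 - cnj \<zeta> = (1 - cnj \<zeta> * a k) - cnj \<zeta> * (1 - a k)" by (simp add: algebra_simps)
      then have "t \<le> cmod (1 - cnj \<zeta> * a k) + cmod (cnj \<zeta> * (1 - a k))"
        unfolding t'[symmetric] by (metis norm_triangle_ineq4)
      also have "\<dots> \<le> cmod (1 - cnj \<zeta> * a k) + C * cmod (1 - cnj \<zeta> * a k)"
        using num[of k] \<zeta> by (simp add: norm_mult)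
      finally show ?thesis by (simp add: algebra_simps)
    qed
    have w_le: "cmod (w k) \<le> C" for k
      using num[of k] den_pos[of k] by (simp add: w_def norm_divide field_simps)
    have w_le2: "cmod (w k) \<le> C * (1 + C) * d k / t" for k
    proof -
      have "cmod (1 - a k) * t \<le> (C * d k) * ((1 + C) * cmod (1 - cnj \<zeta> * a k))"
        using stolz_d[of k] den_t[of k] C_ge_1 d_pos[of k] t by (intro mult_mono) auto
      then show ?thesis using den_pos[of k] t by (simp add: w_def norm_divide field_simps)
    qed
    have w_1: "cmod (w k - 1) \<le> t / d k" for k
    proof -
      have "1 - cnj \<zeta> * a k \<noteq> 0" using den_pos[of k] by auto
      then have "w k - 1 = - (a k * (1 - cnj \<zeta>)) / (1 - cnj \<zeta> * a k)"
        by (simp add: w_def field_simps)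
      then have "cmod (w k - 1) = cmod (a k) * t / cmod (1 - cnj \<zeta> * a k)"
        by (simp add: norm_divide norm_mult t')
      also have "\<dots> \<le> 1 * t / d k"
        using disc[of k] den[of k] d_pos[of k] t by (intro frac_le mult_right_mono) auto
      finally show ?thesis by simp
    qed
    have below: "cmod (\<Phi> \<zeta> k - 1) \<le> B1 * K * q ^ (n - 1 - k)" if "k < n" for k
    proof -
      \<comment> \<open>\<open>n - 1\<close> is the last index with \<open>d\<close> known to be at
        least \<open>t\<close>, while \<open>d n\<close> may lie far below \<open>t\<close>; hence
        the exponent \<open>n - 1 - k\<close>.\<close>
      have "t \<le> d (n - 1)" using lo that by (simp add: t_def)
      also have "\<dots> \<le> K * q ^ (n - 1 - k) * d k" using geo[of k "n - 1 - k"] that by simp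
      finally have "t / d k \<le> K * q ^ (n - 1 - k)" using d_pos[of k] by (simp add: field_simps)
      then show ?thesis
        unfolding \<Phi>w using B1(2)[OF w_le[of k]] mult_left_mono[OF order_trans[OF w_1[of k]] B1(1)]
        by (smt (verit, best) mult.assoc)
    qed
    have above: "cmod (\<Phi> \<zeta> k) \<le> B2 * q' ^ (k - n)" if "n \<le> k" for k
    proof -
      have "d k \<le> K * q ^ (k - n) * d n" using geo[of n "k - n"] that by simp
      also have "\<dots> \<le> K * q ^ (k - n) * t" using hi K q by (intro mult_left_mono) (auto simp: t_def)
      finally have "C * (1 + C) * d k \<le> C * (1 + C) * (K * q ^ (k - n) * t)"
        using C_ge_1 by (intro mult_left_mono) auto
      then have "C * (1 + C) * d k / t \<le> C * (1 + C) * K * q ^ (k - n)"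
        using t by (simp add: pos_divide_le_eq mult.assoc)
      then have "cmod (w k) \<le> C * (1 + C) * K * q ^ (k - n)" using w_le2[of k] by linarith
      then have "cmod (w k) powr \<alpha> \<le> (C * (1 + C) * K * q ^ (k - n)) powr \<alpha>"
        using \<alpha> by (intro powr_mono2) auto
      also have "\<dots> = B2 * q' ^ (k - n)"
        using q C_ge_1 K unfolding B2_def q'_def
        by (simp add: powr_mult powr_powr powr_realpow[symmetric] mult.commute)
      finally show ?thesis by (simp add: \<Phi>w cmod_powr_of_real)
    qed
    have "(\<Sum>k<N. cmod (\<Phi> \<zeta> k - (if k < n then 1 else 0))) \<le> (\<Sum>k\<in>{..<n} \<union> {n..<N}. cmod (\<Phi> \<zeta> k - (if k < n then 1 else 0)))"
      by (intro sum_mono2) auto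
    also have "\<dots> = (\<Sum>k<n. cmod (\<Phi> \<zeta> k - 1)) + (\<Sum>k\<in>{n..<N}. cmod (\<Phi> \<zeta> k))"
      by (subst sum.union_disjoint) auto
    also have "\<dots> \<le> (\<Sum>k<n. B1 * K * q ^ (n - 1 - k)) + (\<Sum>k\<in>{n..<N}. B2 * q' ^ (k - n))"
      using below above by (intro add_mono sum_mono) auto
    also have "\<dots> \<le> B1 * K * (1 / (1 - q)) + B2 * (1 / (1 - q'))"
      unfolding sum_distrib_left[symmetric]
      using q q' B1(1) K by (intro add_mono mult_left_mono sum_power_below_le sum_power_above_le) (auto simp: B2_def)
    finally show "(\<Sum>k<N. cmod (\<Phi> \<zeta> k - (if k < n then 1 else 0))) \<le> B1 * K * (1 / (1 - q)) + B2 * (1 / (1 - q'))" .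
  qed
qed

lemma d_tendsto_0: "d \<longlonglongrightarrow> 0"
proof -
  obtain K q where K: "1 \<le> K" and q: "0 < q" "q < 1" and geo: "\<And>n m. d (n + m) \<le> K * q ^ m * d n"
    using d_geometric by blast
  show ?thesis
  proof (rule tendsto_sandwich[of "\<lambda>_. 0"])
    show "(\<lambda>m. K * q ^ m * d 0) \<longlonglongrightarrow> 0"
      using q by (auto intro!: tendsto_eq_intros LIMSEQ_realpow_zero)
    show "\<forall>\<^sub>F m in sequentially. d m \<le> K * q ^ m * d 0" using geo[of 0] by simp
  qed (use d_pos in \<open>auto simp: less_imp_le\<close>)
qed

lemma kernel_variation:
  "\<exists>B. \<forall>\<zeta> N. cmod \<zeta> = 1 \<longrightarrow> (\<Sum>k<N. cmod (\<Phi> \<zeta> (Suc k) - \<Phi> \<zeta> k)) \<le> B"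
proof -
  obtain B where B: "\<And>\<zeta> n N. \<lbrakk>cmod \<zeta> = 1; \<And>k. k < n \<Longrightarrow> cmod (1 - \<zeta>) \<le> d k; \<And>k. n \<le> k \<Longrightarrow> d k \<le> cmod (1 - \<zeta>)\<rbrakk> \<Longrightarrow>
     (\<Sum>k<N. cmod (\<Phi> \<zeta> k - (if k < n then 1 else 0))) \<le> B"
    using kernel_sums by blast
  show ?thesis
  proof (intro exI allI impI)
    fix \<zeta> N assume \<zeta>: "cmod \<zeta> = 1"
    \<comment> \<open>Each increment is compared with that of the step function
      \<open>\<eta>\<close>: two errors of total size at most \<open>B\<close> each and one unit
      jump. For \<open>\<zeta> = 1\<close> there is no crossing index, but the kernel is
      constant.\<close>
    show "(\<Sum>k<N. cmod (\<Phi> \<zeta> (Suc k) - \<Phi> \<zeta> k)) \<le> 2 * \<bar>B\<bar> + 1"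
    proof (cases "\<zeta> = 1")
      case False
      then have "cmod (1 - \<zeta>) > 0" by simp
      then obtain m where m: "d m \<le> cmod (1 - \<zeta>)"
        using order_tendstoD(2)[OF d_tendsto_0] by (meson eventually_happens' less_imp_le sequentially_bot)
      define n where "n = (LEAST n. d n \<le> cmod (1 - \<zeta>))"
      have n: "d n \<le> cmod (1 - \<zeta>)" "\<And>k. k < n \<Longrightarrow> cmod (1 - \<zeta>) \<le> d k"
        unfolding n_def using LeastI[of "\<lambda>n. d n \<le> cmod (1 - \<zeta>)", OF m] not_less_Least less_imp_le not_le by blast+
      define \<eta> where "\<eta> k = (if k < n then 1 else 0 :: complex)" for k
      have \<eta>: "(\<Sum>k<N. cmod (\<Phi> \<zeta> k - \<eta> k)) \<le> B" for N
        unfolding \<eta>_def using n d_antimono by (intro B \<zeta>) (auto intro: order_trans)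
      have "(\<Sum>k<N. cmod (\<Phi> \<zeta> (Suc k) - \<Phi> \<zeta> k))
          \<le> (\<Sum>k<N. cmod (\<Phi> \<zeta> (Suc k) - \<eta> (Suc k)) + cmod (\<Phi> \<zeta> k - \<eta> k) + (if Suc k = n then 1 else 0))"
      proof (rule sum_mono)
        fix k
        have "\<Phi> \<zeta> (Suc k) - \<Phi> \<zeta> k = (\<Phi> \<zeta> (Suc k) - \<eta> (Suc k)) - (\<Phi> \<zeta> k - \<eta> k) + (\<eta> (Suc k) - \<eta> k)" by simp
        also have "cmod \<dots> \<le> cmod (\<Phi> \<zeta> (Suc k) - \<eta> (Suc k)) + cmod (\<Phi> \<zeta> k - \<eta> k) + cmod (\<eta> (Suc k) - \<eta> k)"
          by (meson add_mono norm_triangle_ineq norm_triangle_ineq4 order_trans order_refl)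
        also have "cmod (\<eta> (Suc k) - \<eta> k) \<le> (if Suc k = n then 1 else 0)"
          by (auto simp: \<eta>_def)
        finally show "cmod (\<Phi> \<zeta> (Suc k) - \<Phi> \<zeta> k) \<le> cmod (\<Phi> \<zeta> (Suc k) - \<eta> (Suc k)) + cmod (\<Phi> \<zeta> k - \<eta> k) + (if Suc k = n then 1 else 0)"
          by simp
      qed
      also have "\<dots> = (\<Sum>k<N. cmod (\<Phi> \<zeta> (Suc k) - \<eta> (Suc k))) + (\<Sum>k<N. cmod (\<Phi> \<zeta> k - \<eta> k)) + (\<Sum>k<N. if Suc k = n then 1 else 0)"
        by (simp only: sum.distrib)
      also have "(\<Sum>k<N. cmod (\<Phi> \<zeta> (Suc k) - \<eta> (Suc k))) \<le> (\<Sum>k<Suc N. cmod (\<Phi> \<zeta> k - \<eta> k))"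
        by (subst sum.lessThan_Suc_shift) simp
      also have "(\<Sum>k<N. if Suc k = n then 1 else 0 :: real) \<le> 1"
      proof -
        have "(\<Sum>k<N. if Suc k = n then 1 else 0 :: real) \<le> (\<Sum>k<N. if k = n - 1 then 1 else 0)"
          by (intro sum_mono) auto
        also have "\<dots> \<le> 1" by simp
        finally show ?thesis .
      qed
      finally show ?thesis using \<eta>[of N] \<eta>[of "Suc N"] by linarith
    qed (simp add: \<Phi>_one)
  qed
qed

text \<open>The variation bound is uniform in \<open>\<zeta>\<close>, so it survives integration.
  Positive measures suffice because \<open>complex_measure_integral\<close> is built from four of
  them.\<close>

lemma measure_transform_variation:
  assumes fin: "finite_measure \<mu>" and sets_\<mu> [measurable_cong]: "sets \<mu> = sets circle_borel"
  shows "summable (\<lambda>k. cmod ((LINT \<zeta>|\<mu>. \<Phi> \<zeta> (Suc k)) - (LINT \<zeta>|\<mu>. \<Phi> \<zeta> k)))"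
proof -
  interpret finite_measure \<mu> by (rule fin)
  have space_\<mu>: "space \<mu> = sphere 0 1"
    using sets_eq_imp_space_eq[OF sets_\<mu>] by (simp add: space_restrict_space)
  obtain B where B: "\<And>\<zeta> N. cmod \<zeta> = 1 \<Longrightarrow> (\<Sum>k<N. cmod (\<Phi> \<zeta> (Suc k) - \<Phi> \<zeta> k)) \<le> B"
    using kernel_variation by blast
  have [measurable]: "(\<lambda>\<zeta>. \<Phi> \<zeta> k) \<in> borel_measurable \<mu>" for k
    unfolding \<Phi>_def
    by (intro borel_measurable_times borel_measurable_const)
       (use kernel_measurable[OF disc] in \<open>simp add: measurable_cong_sets[OF sets_\<mu> refl]\<close>)
  have int: "integrable \<mu> (\<lambda>\<zeta>. \<Phi> \<zeta> k)" for k
  proof (rule integrable_const_bound)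
    show "AE \<zeta> in \<mu>. cmod (\<Phi> \<zeta> k) \<le> cmod ((1 - a k) powr of_real \<alpha>) * (1 / (1 - cmod (a k)) powr \<alpha>)"
      unfolding \<Phi>_def norm_mult using kernel_bound[OF disc, of \<alpha> _ k] \<alpha>
      by (intro AE_I2 mult_left_mono) (auto simp: space_\<mu>)
  qed auto
  show ?thesis
  proof (rule summableI_nonneg_bounded)
    fix N
    have "(\<Sum>k<N. cmod ((LINT \<zeta>|\<mu>. \<Phi> \<zeta> (Suc k)) - (LINT \<zeta>|\<mu>. \<Phi> \<zeta> k)))
        \<le> (\<Sum>k<N. LINT \<zeta>|\<mu>. cmod (\<Phi> \<zeta> (Suc k) - \<Phi> \<zeta> k))"
      using int by (intro sum_mono) (simp flip: Bochner_Integration.integral_diff)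
    also have "\<dots> = (LINT \<zeta>|\<mu>. (\<Sum>k<N. cmod (\<Phi> \<zeta> (Suc k) - \<Phi> \<zeta> k)))"
      using int by (intro Bochner_Integration.integral_sum[symmetric]) auto
    also have "\<dots> \<le> (LINT \<zeta>|\<mu>. B)"
      using int B by (intro integral_mono) (auto simp: space_\<mu>)
    finally show "(\<Sum>k<N. cmod ((LINT \<zeta>|\<mu>. \<Phi> \<zeta> (Suc k)) - (LINT \<zeta>|\<mu>. \<Phi> \<zeta> k))) \<le> (LINT \<zeta>|\<mu>. B)" .
  qed auto
qed

lemma F_space_imp_bv_seq:
  assumes "g \<in> F_space \<alpha>"
  shows "(\<lambda>k. (1 - a k) powr of_real \<alpha> * g (a k)) \<in> bv_seq"
proof -
  obtain \<nu> where \<nu>: "complex_measure circle_borel \<nu>"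
    and g: "\<And>z. cmod z < 1 \<Longrightarrow> g z = complex_measure_integral circle_borel \<nu> (\<lambda>\<zeta>. 1 / (1 - cnj \<zeta> * z) powr of_real \<alpha>)"
    using assms by (auto simp: F_space_def)
  have Re: "(\<lambda>n. Re (\<nu> (A n))) sums Re (\<nu> (\<Union>n. A n))" and Im: "(\<lambda>n. Im (\<nu> (A n))) sums Im (\<nu> (\<Union>n. A n))"
    if "range A \<subseteq> sets circle_borel" "disjoint_family A" for A :: "nat \<Rightarrow> _"
    using \<nu> that unfolding complex_measure_def by (auto intro: sums_Re sums_Im)
  define U where "U \<sigma> = upper_variation circle_borel (\<lambda>A. \<sigma> (\<nu> A))" for \<sigma> :: "complex \<Rightarrow> real"
  define I where "I \<sigma> k = (LINT \<zeta>|U \<sigma>. \<Phi> \<zeta> k)" for \<sigma> k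
  have var: "summable (\<lambda>k. cmod (I \<sigma> (Suc k) - I \<sigma> k))" if "\<sigma> \<in> {Re, \<lambda>z. - Re z, Im, \<lambda>z. - Im z}" for \<sigma>
    unfolding I_def U_def
    by (rule measure_transform_variation, rule finite_measure_upper_variation)
       (use that Re Im in \<open>auto intro: sums_minus\<close>)
  have eq: "(1 - a k) powr of_real \<alpha> * g (a k)
      = (I Re k - I (\<lambda>z. - Re z) k) + \<i> * (I Im k - I (\<lambda>z. - Im z) k)" for k
    unfolding I_def U_def \<Phi>_def g[OF disc] complex_measure_integral_def
    by (simp only: integral_mult_right_zero) (simp add: algebra_simps)
  have bound: "cmod ((p' - q' + \<i> * (r' - s')) - (p - q + \<i> * (r - s)))
      \<le> cmod (p' - p) + cmod (q' - q) + (cmod (r' - r) + cmod (s' - s))" for p q r s p' q' r' s'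
  proof -
    have "(p' - q' + \<i> * (r' - s')) - (p - q + \<i> * (r - s)) = ((p' - p) - (q' - q)) + \<i> * ((r' - r) - (s' - s))"
      by (simp add: algebra_simps)
    also have "cmod \<dots> \<le> cmod ((p' - p) - (q' - q)) + cmod ((r' - r) - (s' - s))"
      by (metis norm_triangle_ineq norm_mult norm_ii mult_1)
    also have "\<dots> \<le> cmod (p' - p) + cmod (q' - q) + (cmod (r' - r) + cmod (s' - s))"
      by (intro add_mono norm_triangle_ineq4)
    finally show ?thesis .
  qed
  have "summable (\<lambda>k. cmod (I Re (Suc k) - I Re k) + cmod (I (\<lambda>z. - Re z) (Suc k) - I (\<lambda>z. - Re z) k)
      + (cmod (I Im (Suc k) - I Im k) + cmod (I (\<lambda>z. - Im z) (Suc k) - I (\<lambda>z. - Im z) k)))"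
    by (intro summable_add var) auto
  then show ?thesis
    unfolding bv_seq_def mem_Collect_eq eq
    by (rule summable_comparison_test'[where N = 0]) (use bound in auto)
qed

end

section \<open>Functions represented by an integrable density\<close>

text \<open>\<open>w\<close> stands for the conjugate of the point of the circle: in this variable
  the kernel is holomorphic on the disc, which makes Cauchy's formula applicable.\<close>

definition ckernel :: "real \<Rightarrow> complex \<Rightarrow> complex \<Rightarrow> complex" where
  "ckernel \<alpha> w z = 1 / (1 - w * z) powr of_real \<alpha>"

lemma kernel_continuous:
  assumes "cmod z < 1"
  shows "continuous_on (cball 0 1) (\<lambda>w. ckernel \<alpha> w z)"
proof -
  have pos: "Re (1 - w * z) > 0" if "w \<in> cball 0 1" for w
    using that assms complex_Re_le_cmod[of "w * z"] mult_left_le_one_le[of "cmod z" "cmod w"]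
    by (simp add: norm_mult)
  show ?thesis
    unfolding ckernel_def
  proof (intro continuous_on_divide continuous_on_powr_complex)
    show "cball 0 1 \<subseteq> {w. 0 \<le> Re (1 - w * z) \<or> Im (1 - w * z) \<noteq> 0}"
      using pos less_imp_le by blast
    show "0 < Re (of_real \<alpha>)" if "w \<in> cball 0 1" "1 - w * z = 0" for w
      using pos[OF that(1)] that(2) by simp
    show "\<forall>w\<in>cball 0 1. (1 - w * z) powr of_real \<alpha> \<noteq> 0"
      using pos by fastforce
  qed (auto intro!: continuous_intros)
qed

lemma norm_kernel_le:
  assumes "cmod w \<le> 1" "cmod z < 1" "\<alpha> \<ge> 0"
  shows "cmod (ckernel \<alpha> w z) \<le> 1 / (1 - cmod z) powr \<alpha>"
  using kernel_bound[of z \<alpha> "cnj w"] assms by (simp add: ckernel_def)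

lemma borel_measurable_kernel:
  assumes [measurable]: "f \<in> borel_measurable M" and "\<And>x. cmod (f x) \<le> 1" "cmod z < 1"
  shows "(\<lambda>x. ckernel \<alpha> (f x) z) \<in> borel_measurable M"
proof -
  have "(\<lambda>w. ckernel \<alpha> w z) \<in> borel_measurable (restrict_space borel (cball 0 1))"
    by (intro borel_measurable_continuous_on_restrict kernel_continuous assms)
  moreover have "f \<in> measurable M (restrict_space borel (cball 0 1))"
    using assms(2) by (intro measurable_restrict_space2) auto
  ultimately show ?thesis by (rule measurable_compose[rotated])
qed

lemma integrable_mult_kernel:
  fixes f :: "'a \<Rightarrow> complex"
  assumes f: "integrable M f" and \<phi>: "\<phi> \<in> borel_measurable M" "\<And>x. cmod (\<phi> x) \<le> 1" "cmod z < 1" "\<alpha> \<ge> 0"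
  shows "integrable M (\<lambda>x. f x * ckernel \<alpha> (\<phi> x) z)"
proof (rule Bochner_Integration.integrable_bound)
  show "integrable M (\<lambda>x. f x * of_real (1 / (1 - cmod z) powr \<alpha>))" using f by simp
  show "AE x in M. norm (f x * ckernel \<alpha> (\<phi> x) z) \<le> norm (f x * of_real (1 / (1 - cmod z) powr \<alpha>))"
    unfolding norm_mult norm_of_real
    by (intro AE_I2 mult_left_mono order_trans[OF norm_kernel_le abs_ge_self]) (use assms in auto)
qed (use f borel_measurable_kernel[OF \<phi>(1-3)] in auto)

text \<open>The conjugate is absorbed into the parametrisation: the mass \<open>f t\<close> sits at
  the conjugate of \<open>cis (2 * pi * t)\<close>. The bound \<open>B\<close> is recorded because
  infinite series of such functions are formed later.\<close>

definition circle_density :: "real \<Rightarrow> real \<Rightarrow> (complex \<Rightarrow> complex) \<Rightarrow> bool" where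
  "circle_density \<alpha> B g \<longleftrightarrow> (\<exists>f :: real \<Rightarrow> complex. integrable lborel f \<and> (\<forall>t. t \<notin> {0..1} \<longrightarrow> f t = 0) \<and>
     (LINT t|lborel. cmod (f t)) \<le> B \<and>
     (\<forall>z. cmod z < 1 \<longrightarrow> g z = (LINT t|lborel. f t * ckernel \<alpha> (cis (2 * pi * t)) z)))"

lemma borel_measurable_cis_circle [measurable]: "(\<lambda>t. cis (2 * pi * t)) \<in> borel_measurable borel"
  by (intro borel_measurable_continuous_onI continuous_intros)

lemma circle_density_cong:
  "circle_density \<alpha> B g \<Longrightarrow> (\<And>z. cmod z < 1 \<Longrightarrow> g z = g' z) \<Longrightarrow> B \<le> B' \<Longrightarrow> circle_density \<alpha> B' g'"
  unfolding circle_density_def by (elim ex_forward) auto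

lemma circle_density_add:
  assumes "circle_density \<alpha> B1 g1" "circle_density \<alpha> B2 g2" "\<alpha> \<ge> 0"
  shows "circle_density \<alpha> (B1 + B2) (\<lambda>z. g1 z + g2 z)"
proof -
  obtain f1 where f1: "integrable lborel f1" "\<forall>t. t \<notin> {0..1} \<longrightarrow> f1 t = 0"
    "(LINT t|lborel. cmod (f1 t)) \<le> B1"
    "\<forall>z. cmod z < 1 \<longrightarrow> g1 z = (LINT t|lborel. f1 t * ckernel \<alpha> (cis (2 * pi * t)) z)"
    using assms(1) unfolding circle_density_def by blast
  obtain f2 where f2: "integrable lborel f2" "\<forall>t. t \<notin> {0..1} \<longrightarrow> f2 t = 0"
    "(LINT t|lborel. cmod (f2 t)) \<le> B2"
    "\<forall>z. cmod z < 1 \<longrightarrow> g2 z = (LINT t|lborel. f2 t * ckernel \<alpha> (cis (2 * pi * t)) z)"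
    using assms(2) unfolding circle_density_def by blast
  note f = f1 f2
  have "(LINT t|lborel. cmod (f1 t + f2 t)) \<le> (LINT t|lborel. cmod (f1 t) + cmod (f2 t))"
    using f by (intro integral_mono norm_triangle_ineq) auto
  then have "(LINT t|lborel. cmod (f1 t + f2 t)) \<le> B1 + B2" using f by simp
  moreover have "g1 z + g2 z = (LINT t|lborel. (f1 t + f2 t) * ckernel \<alpha> (cis (2 * pi * t)) z)" if "cmod z < 1" for z
    using f assms(3) that integrable_mult_kernel[of lborel _ "\<lambda>t. cis (2 * pi * t)" z \<alpha>]
    by (simp add: distrib_right)
  ultimately show ?thesis
    unfolding circle_density_def using f by (intro exI[of _ "\<lambda>t. f1 t + f2 t"]) auto
qed

lemma circle_density_scale:
  assumes "circle_density \<alpha> B g"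
  shows "circle_density \<alpha> (cmod c * B) (\<lambda>z. c * g z)"
proof -
  obtain f where f: "integrable lborel f" "\<forall>t. t \<notin> {0..1} \<longrightarrow> f t = 0"
    "(LINT t|lborel. cmod (f t)) \<le> B"
    "\<forall>z. cmod z < 1 \<longrightarrow> g z = (LINT t|lborel. f t * ckernel \<alpha> (cis (2 * pi * t)) z)"
    using assms unfolding circle_density_def by blast
  then show ?thesis
    unfolding circle_density_def
    by (intro exI[of _ "\<lambda>t. c * f t"]) (auto simp: norm_mult mult.assoc mult_left_mono)
qed

section \<open>Densities from Cauchy's formula at a real point \<open>b\<close>\<close>

lemma circlepath_lborel_integral:
  assumes cont: "continuous_on (sphere 0 1) F" and F: "(F has_contour_integral I) (circlepath 0 1)"
  shows "set_integrable lborel {0..1} (\<lambda>t. F (cis (2 * pi * t)) * cis (2 * pi * t))"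
    and "(LINT t:{0..1}|lborel. F (cis (2 * pi * t)) * cis (2 * pi * t)) = I / (2 * of_real pi * \<i>)"
proof -
  have cont': "continuous_on {0..1} (\<lambda>t. F (cis (2 * pi * t)) * cis (2 * pi * t))"
    by (intro continuous_intros continuous_on_compose2[OF cont]) auto
  show int: "set_integrable lborel {0..1} (\<lambda>t. F (cis (2 * pi * t)) * cis (2 * pi * t))"
    by (rule borel_integrable_atLeastAtMost'[OF cont'])
  \<comment> \<open>On the unit circle \<open>du = 2 * pi * \<i> * u * dt\<close>, the origin of the
    additional factor \<open>cis\<close>.\<close>
  have "circlepath 0 1 t = cis (2 * pi * t)"
      "vector_derivative (circlepath 0 1) (at t) = 2 * pi * \<i> * cis (2 * pi * t)" for t
    unfolding vector_derivative_circlepath by (simp_all add: circlepath cis_conv_exp mult_ac)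
  then have "((\<lambda>t. F (cis (2 * pi * t)) * (2 * pi * \<i> * cis (2 * pi * t))) has_integral I) {0..1}"
    using F unfolding has_contour_integral by simp
  from has_integral_mult_left[OF this, of "1 / (2 * of_real pi * \<i>)"]
  have "((\<lambda>t. F (cis (2 * pi * t)) * cis (2 * pi * t)) has_integral I / (2 * of_real pi * \<i>)) {0..1}"
    by (simp add: mult_ac)
  then show "(LINT t:{0..1}|lborel. F (cis (2 * pi * t)) * cis (2 * pi * t)) = I / (2 * of_real pi * \<i>)"
    using set_borel_integral_eq_integral(2)[OF int] integral_unique by metis
qed

lemma cmod_cis_diff_ge: "b \<le> 1 \<Longrightarrow> 1 - b \<le> cmod (cis t - of_real b)" if "0 \<le> b"
  using norm_triangle_ineq2[of "cis t" "of_real b"] that by simp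

text \<open>Up to the factor \<open>1 + b\<close> this is the Poisson kernel. On the circle
  \<open>1 / cmod (u - b)^2\<close> equals \<open>u / ((u - b) * (1 - b * u))\<close>, so Cauchy's
  formula for \<open>1 / (1 - b * u)\<close> at \<open>b\<close> gives the mean
  \<open>1 / (1 - b^2)\<close>.\<close>

lemma poisson_integral:
  assumes b: "0 \<le> b" "b < 1"
  shows "set_integrable lborel {0..1} (\<lambda>t. (1 - b) / (cmod (cis (2 * pi * t) - of_real b))\<^sup>2)"
    and "(LINT t:{0..1}|lborel. (1 - b) / (cmod (cis (2 * pi * t) - of_real b))\<^sup>2) \<le> 1"
proof -
  have ne: "cis t - of_real b \<noteq> 0" for t
    using cmod_cis_diff_ge[of b t] b by auto
  have nz: "1 - of_real b * w \<noteq> 0" if "cmod w \<le> 1" for w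
  proof
    assume "1 - of_real b * w = 0"
    then have "cmod (of_real b * w) = 1" by (metis norm_one right_minus_eq)
    then have "b * cmod w = 1" using b by (simp add: norm_mult)
    moreover have "b * cmod w \<le> b * 1" using that b by (intro mult_left_mono) auto
    ultimately show False using b by simp
  qed
  define F :: "complex \<Rightarrow> complex" where "F u = 1 / (1 - of_real b * u) / (u - of_real b)" for u
  have "(F has_contour_integral 2 * of_real pi * \<i> * (1 / (1 - of_real b * of_real b))) (circlepath 0 1)"
    unfolding F_def
    by (rule Cauchy_integral_circlepath_simple) (use nz b in \<open>auto intro!: holomorphic_intros\<close>)
  moreover have "continuous_on (sphere 0 1) F"
    unfolding F_def using nz b by (auto intro!: continuous_intros)
  ultimately have I: "(LINT t:{0..1}|lborel. F (cis (2 * pi * t)) * cis (2 * pi * t)) = 1 / (1 - of_real b * of_real b)"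
    by (subst circlepath_lborel_integral) auto
  have FF: "F (cis t) * cis t = of_real (1 / (cmod (cis t - of_real b))\<^sup>2)" for t
  proof -
    have "of_real ((cmod (cis t - of_real b))\<^sup>2) = (cis t - of_real b) * cnj (cis t - of_real b)"
      by (rule complex_norm_square)
    also have "cnj (cis t - of_real b) = (1 - of_real b * cis t) / cis t"
      by (simp add: cis_cnj diff_divide_distrib cis_inverse[symmetric] inverse_eq_divide)
    finally have "of_real ((cmod (cis t - of_real b))\<^sup>2) = (cis t - of_real b) * ((1 - of_real b * cis t) / cis t)" .
    then show ?thesis
      unfolding F_def of_real_divide of_real_1 using ne[of t] nz[of "cis t"] by simp
  qed
  have "continuous_on {0..1} (\<lambda>t. (1 - b) / (cmod (cis (2 * pi * t) - of_real b))\<^sup>2)"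
    using ne by (auto intro!: continuous_intros)
  then show "set_integrable lborel {0..1} (\<lambda>t. (1 - b) / (cmod (cis (2 * pi * t) - of_real b))\<^sup>2)"
    by (rule borel_integrable_atLeastAtMost')
  have "complex_of_real (LINT t:{0..1}|lborel. 1 / (cmod (cis (2 * pi * t) - of_real b))\<^sup>2)
      = of_real (1 / (1 - b * b))"
    using I unfolding FF set_integral_complex_of_real by simp
  then have eq: "(LINT t:{0..1}|lborel. 1 / (cmod (cis (2 * pi * t) - of_real b))\<^sup>2) = 1 / (1 - b * b)"
    unfolding of_real_eq_iff .
  have "(LINT t:{0..1}|lborel. (1 - b) / (cmod (cis (2 * pi * t) - of_real b))\<^sup>2)
      = (1 - b) * (LINT t:{0..1}|lborel. 1 / (cmod (cis (2 * pi * t) - of_real b))\<^sup>2)"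
    by (subst set_integral_mult_right[symmetric]) simp
  also have "\<dots> = 1 / (1 + b)"
  proof -
    have "1 - b * b = (1 - b) * (1 + b)" by (simp add: algebra_simps)
    then show ?thesis using b by (simp add: eq)
  qed
  also have "\<dots> \<le> 1" using b by simp
  finally show "(LINT t:{0..1}|lborel. (1 - b) / (cmod (cis (2 * pi * t) - of_real b))\<^sup>2) \<le> 1" .
qed

lemma higher_deriv_kernel:
  assumes z: "cmod z < 1" and w: "w \<in> ball 0 1"
  shows "(deriv ^^ k) (\<lambda>w. ckernel \<alpha> w z) w
    = pochhammer (of_real \<alpha>) k * z ^ k / (1 - w * z) ^ k * ckernel \<alpha> w z"
  using w
proof (induction k arbitrary: w)
  case (Suc k)
  have nz: "1 - w * z \<notin> \<real>\<^sub>\<le>\<^sub>0"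
    using kernel_not_nonpos'[of "cnj w" z] Suc.prems z by simp
  then have ne: "1 - w * z \<noteq> 0" by auto
  \<comment> \<open>As a single power the expression is differentiated in one step, and the new
    factor \<open>\<alpha> + k\<close> is the next one of the Pochhammer symbol.\<close>
  have form: "pochhammer (of_real \<alpha>) j * z ^ j / (1 - v * z) ^ j * ckernel \<alpha> v z
      = pochhammer (of_real \<alpha>) j * z ^ j * (1 - v * z) powr (- of_real \<alpha> - of_nat j)"
    if "1 - v * z \<noteq> 0" for v j
    using that by (simp add: ckernel_def powr_diff powr_minus powr_nat' field_simps)
  have "(deriv ^^ Suc k) (\<lambda>w. ckernel \<alpha> w z) w
      = deriv (\<lambda>w. pochhammer (of_real \<alpha>) k * z ^ k * (1 - w * z) powr (- of_real \<alpha> - of_nat k)) w"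
    unfolding funpow.simps o_def
  proof (rule deriv_cong_ev)
    have "eventually (\<lambda>v. v \<in> ball 0 1) (nhds w)" using Suc.prems by (intro eventually_nhds_in_open) auto
    then show "\<forall>\<^sub>F v in nhds w. (deriv ^^ k) (\<lambda>w. ckernel \<alpha> w z) v
        = pochhammer (of_real \<alpha>) k * z ^ k * (1 - v * z) powr (- of_real \<alpha> - of_nat k)"
    proof eventually_elim
      case (elim v)
      then have "1 - v * z \<noteq> 0" using kernel_not_nonpos'[of "cnj v" z] z by auto
      then show ?case using Suc.IH[OF elim] form by simp
    qed
  qed simp
  also have "\<dots> = pochhammer (of_real \<alpha>) k * z ^ k *
      ((- of_real \<alpha> - of_nat k) * (1 - w * z) powr (- of_real \<alpha> - of_nat k - 1) * (- z))"
    by (rule DERIV_imp_deriv) (use nz in \<open>auto intro!: derivative_eq_intros\<close>)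
  also have "\<dots> = pochhammer (of_real \<alpha>) (Suc k) * z ^ Suc k * (1 - w * z) powr (- of_real \<alpha> - of_nat (Suc k))"
    by (simp add: pochhammer_Suc algebra_simps)
  finally show ?case by (simp only: form[OF ne])
qed simp

lemma kernel_holomorphic:
  assumes "cmod z < 1"
  shows "(\<lambda>w. ckernel \<alpha> w z) holomorphic_on ball 0 1"
proof -
  have nz: "1 - w * z \<notin> \<real>\<^sub>\<le>\<^sub>0" if "w \<in> ball 0 1" for w
    using kernel_not_nonpos'[of "cnj w" z] that assms by simp
  then show ?thesis
    unfolding ckernel_def by (intro holomorphic_intros) force+
qed

text \<open>The factor \<open>z / (1 - b * z)\<close> that each derivative of the kernel at
  \<open>b\<close> contributes, scaled by \<open>1 - b\<close> so that it is bounded by 1 on the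
  disc.\<close>

definition mob :: "real \<Rightarrow> complex \<Rightarrow> complex" where
  "mob b z = of_real (1 - b) * z / (1 - of_real b * z)"

text \<open>Cauchy's formula for the \<open>i\<close>-th derivative at \<open>b\<close> has the
  density \<open>u / (u - b) ^ Suc i\<close>. For \<open>i > 0\<close> the factor
  \<open>(1 - b) ^ i\<close> leaves at most \<open>(1 - b) / cmod (u - b)^2\<close>, because
  \<open>cmod (u - b) \<ge> 1 - b\<close>, and the integral of this is at most 1.\<close>

lemma circle_density_mob_power:
  assumes \<alpha>: "\<alpha> > 0"
  shows "\<exists>c\<ge>0. \<forall>b. 0 \<le> b \<longrightarrow> b < 1 \<longrightarrow>
    circle_density \<alpha> c (\<lambda>z. of_real (if i = 0 then 1 - b else 1) * mob b z ^ i * ckernel \<alpha> (of_real b) z)"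
proof (intro exI conjI allI impI)
  \<comment> \<open>The quotient undoes the \<open>1 / fact i\<close> of Cauchy's formula and the
    Pochhammer factor of the derivative.\<close>
  define c where "c = fact i / pochhammer \<alpha> i"
  have poch: "pochhammer \<alpha> i > 0" using \<alpha> by (rule pochhammer_pos)
  then show c: "c \<ge> 0" by (simp add: c_def)
  fix b :: real assume b: "0 \<le> b" "b < 1"
  define \<theta> where "\<theta> = (if i = 0 then 1 - b else (1 - b) ^ i)"
  have ne: "cis t - of_real b \<noteq> 0" for t
    using cmod_cis_diff_ge[of b t] b by auto
  define k where "k t = of_real (\<theta> * c) * (cis (2 * pi * t) / (cis (2 * pi * t) - of_real b) ^ Suc i)" for t
  have contk: "continuous_on {0..1} k"
    unfolding k_def using ne by (auto intro!: continuous_intros)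
  have intk: "set_integrable lborel {0..1} k"
    by (rule borel_integrable_atLeastAtMost'[OF contk])
  have bound: "cmod (k t) \<le> c * (if i = 0 then 1 else (1 - b) / (cmod (cis (2 * pi * t) - of_real b))\<^sup>2)" for t
  proof -
    define x where "x = cmod (cis (2 * pi * t) - of_real b)"
    have x: "1 - b \<le> x" "x > 0" using cmod_cis_diff_ge[of b "2 * pi * t"] b by (auto simp: x_def)
    have "cmod (k t) = c * (\<theta> / x ^ Suc i)"
      using b c by (simp add: k_def norm_mult norm_divide norm_power x_def \<theta>_def)
    also have "\<dots> \<le> c * (if i = 0 then 1 else (1 - b) / x\<^sup>2)"
    proof (cases i)
      case (Suc j)
      have "\<theta> / x ^ Suc i = ((1 - b) / x) ^ j * ((1 - b) / x\<^sup>2)"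
        using x by (simp add: \<theta>_def Suc power_divide power2_eq_square mult_ac)
      also have "\<dots> \<le> 1 * ((1 - b) / x\<^sup>2)"
        using x b by (intro mult_right_mono power_le_one) auto
      finally have "\<theta> / x ^ Suc i \<le> (1 - b) / x\<^sup>2" by simp
      then show ?thesis using Suc c by (intro mult_left_mono) auto
    next
      case 0
      then have "\<theta> / x ^ Suc i \<le> 1" using x b by (simp add: \<theta>_def)
      then show ?thesis using 0 c by (intro mult_left_mono) auto
    qed
    finally show ?thesis unfolding x_def .
  qed
  have normk: "(LINT t:{0..1}|lborel. cmod (k t)) \<le> c"
  proof (cases "i = 0")
    case True
    have "(LINT t:{0..1}|lborel. cmod (k t)) \<le> (LINT t:{0..1::real}|lborel. c)"
      using bound True set_integrable_norm[OF intk]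
      by (intro set_integral_mono) (auto simp: set_integrable_def)
    then show ?thesis by (simp add: set_lebesgue_integral_def)
  next
    case False
    have "(LINT t:{0..1}|lborel. cmod (k t))
        \<le> (LINT t:{0..1}|lborel. c * ((1 - b) / (cmod (cis (2 * pi * t) - of_real b))\<^sup>2))"
      by (intro set_integral_mono set_integrable_mult_right poisson_integral(1)[OF b] set_integrable_norm[OF intk])
         (use bound False in auto)
    also have "\<dots> = c * (LINT t:{0..1}|lborel. (1 - b) / (cmod (cis (2 * pi * t) - of_real b))\<^sup>2)"
      by (rule set_integral_mult_right)
    also have "\<dots> \<le> c * 1" using poisson_integral(2)[OF b] c by (rule mult_left_mono)
    finally show ?thesis by simp
  qed
  have rep: "of_real (if i = 0 then 1 - b else 1) * mob b z ^ i * ckernel \<alpha> (of_real b) z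
      = (LINT t:{0..1}|lborel. k t * ckernel \<alpha> (cis (2 * pi * t)) z)" if z: "cmod z < 1" for z
  proof -
    define F where "F u = ckernel \<alpha> u z / (u - of_real b) ^ Suc i" for u
    have bb: "of_real b \<in> ball (0::complex) 1" using b by simp
    have F: "(F has_contour_integral (2 * pi * \<i> / fact i * (deriv ^^ i) (\<lambda>w. ckernel \<alpha> w z) (of_real b))) (circlepath 0 1)"
      unfolding F_def
      by (rule Cauchy_has_contour_integral_higher_derivative_circlepath
          [OF kernel_continuous[OF z] kernel_holomorphic[OF z] bb])
    have contF: "continuous_on (sphere 0 1) F"
      unfolding F_def using b
      by (intro continuous_intros continuous_on_subset[OF kernel_continuous[OF z]]) auto
    have "(LINT t:{0..1}|lborel. k t * ckernel \<alpha> (cis (2 * pi * t)) z)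
        = (LINT t:{0..1}|lborel. of_real (\<theta> * c) * (F (cis (2 * pi * t)) * cis (2 * pi * t)))"
      by (simp add: k_def F_def mult_ac)
    also have "\<dots> = of_real (\<theta> * c) * (LINT t:{0..1}|lborel. F (cis (2 * pi * t)) * cis (2 * pi * t))"
      by (rule set_integral_mult_right)
    also have "\<dots> = of_real (\<theta> * c) * (1 / fact i * (deriv ^^ i) (\<lambda>w. ckernel \<alpha> w z) (of_real b))"
      unfolding circlepath_lborel_integral(2)[OF contF F] by simp
    also have "\<dots> = of_real \<theta> * (z / (1 - of_real b * z)) ^ i * ckernel \<alpha> (of_real b) z"
      unfolding higher_deriv_kernel[OF z bb] using poch
      by (simp add: c_def pochhammer_of_real power_divide)
    also have "of_real \<theta> * (z / (1 - of_real b * z)) ^ i = of_real (if i = 0 then 1 - b else 1) * mob b z ^ i"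
      by (simp add: mob_def \<theta>_def power_mult_distrib power_divide)
    finally show ?thesis by simp
  qed
  show "circle_density \<alpha> c (\<lambda>z. of_real (if i = 0 then 1 - b else 1) * mob b z ^ i * ckernel \<alpha> (of_real b) z)"
    unfolding circle_density_def
  proof (intro exI conjI allI impI)
    show "integrable lborel (\<lambda>t. indicator {0..1} t *\<^sub>R k t)"
      using intk by (simp add: set_integrable_def)
    show "(LINT t|lborel. cmod (indicator {0..1} t *\<^sub>R k t)) \<le> c"
      using normk by (simp add: set_lebesgue_integral_def)
  qed (use rep in \<open>auto simp: set_lebesgue_integral_def\<close>)
qed

text \<open>
  The bound must not depend on the roots \<open>cs\<close>, hence the induction on their number. For \<open>i = 0\<close> the
  density of \<open>(1 - b z) powr (-\<alpha>)\<close> is \<open>1 / |w - b|\<close>, which is bounded in \<open>L\<^sup>1\<close> only after multiplication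
  by \<open>1 - b\<close>.
\<close>

lemma circle_density_roots:
  assumes \<alpha>: "\<alpha> > 0"
  shows "\<exists>c\<ge>0. \<forall>b cs. 0 \<le> b \<longrightarrow> b < 1 \<longrightarrow> length cs \<le> N \<longrightarrow> (\<forall>x\<in>set cs. cmod x \<le> 1) \<longrightarrow>
    circle_density \<alpha> c (\<lambda>z. of_real (if i = 0 then 1 - b else 1) * mob b z ^ i *
      (\<Prod>x\<leftarrow>cs. of_real b * mob b z + of_real (1 - b) - x) * ckernel \<alpha> (of_real b) z)"
proof (induction N arbitrary: i)
  case 0
  then show ?case using circle_density_mob_power[OF \<alpha>, of i] by auto
next
  case (Suc N)
  let ?\<theta> = "\<lambda>i (b :: real). of_real (if i = 0 then 1 - b else 1) :: complex"
  let ?g = "\<lambda>i (b :: real) cs z. ?\<theta> i b * mob b z ^ i *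
      (\<Prod>x\<leftarrow>cs. of_real b * mob b z + of_real (1 - b) - x) * ckernel \<alpha> (of_real b) z"
  obtain c where c: "c \<ge> 0" "\<And>(b :: real) cs. \<lbrakk>0 \<le> b; b < 1; length cs \<le> N; \<forall>x\<in>set cs. cmod x \<le> 1\<rbrakk> \<Longrightarrow> circle_density \<alpha> c (?g i b cs)"
    using Suc[of i] by auto
  obtain c' where c': "c' \<ge> 0" "\<And>(b :: real) cs. \<lbrakk>0 \<le> b; b < 1; length cs \<le> N; \<forall>x\<in>set cs. cmod x \<le> 1\<rbrakk> \<Longrightarrow> circle_density \<alpha> c' (?g (Suc i) b cs)"
    using Suc[of "Suc i"] by auto
  show ?case
  proof (intro exI[of _ "c' + 2 * c"] conjI allI impI)
    show "0 \<le> c' + 2 * c" using c c' by simp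
    fix b :: real and cs assume b: "0 \<le> b" "b < 1" and cs: "length cs \<le> Suc N" "\<forall>x\<in>set cs. cmod x \<le> 1"
    show "circle_density \<alpha> (c' + 2 * c) (?g i b cs)"
    proof (cases cs)
      case Nil
      then show ?thesis using c(2)[of b "[]"] c c' b by (auto intro: circle_density_cong)
    next
      case (Cons y ys)
      have y: "cmod y \<le> 1" and ys: "length ys \<le> N" "\<forall>x\<in>set ys. cmod x \<le> 1" using cs Cons by auto
      have norm1: "cmod (?\<theta> i b * of_real b) \<le> 1"
        using b mult_le_one[of "1 - b" b] by (auto simp: norm_mult)
      have norm2: "cmod (of_real (1 - b) - y) \<le> 2"
      proof -
        have "cmod (of_real (1 - b)) \<le> 1" unfolding norm_of_real using b by simp
        then show ?thesis using norm_triangle_ineq4[of "of_real (1 - b)" y] y by linarith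
      qed
      \<comment> \<open>Expanding the factor of \<open>y\<close> gives one term with
        \<open>i\<close> raised by one and one with \<open>i\<close> kept, both with one root fewer.
        For \<open>i = 0\<close> the normalising factor \<open>1 - b\<close> moves into the
        coefficient of the first term, which carries none itself.\<close>
      have "circle_density \<alpha> (cmod (?\<theta> i b * of_real b) * c' + cmod (of_real (1 - b) - y) * c)
          (\<lambda>z. (?\<theta> i b * of_real b) * ?g (Suc i) b ys z + (of_real (1 - b) - y) * ?g i b ys z)"
        using \<alpha> b ys c(2) c'(2) by (intro circle_density_add circle_density_scale) auto
      moreover have "cmod (?\<theta> i b * of_real b) * c' + cmod (of_real (1 - b) - y) * c \<le> 1 * c' + 2 * c"
        using norm1 norm2 c c' by (intro add_mono mult_right_mono)
      ultimately show ?thesis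
        unfolding Cons by (elim circle_density_cong) (auto simp: algebra_simps)
    qed
  qed
qed

definition cay :: "real \<Rightarrow> complex \<Rightarrow> complex" where
  "cay b z = of_real (1 - b) / (1 - of_real b * z)"

lemma cay_eq_mob:
  assumes "1 - of_real b * z \<noteq> 0"
  shows "cay b z = of_real b * mob b z + of_real (1 - b)"
  using assms by (simp add: cay_def mob_def field_simps)

text \<open>The factor \<open>cay b z\<close> in front makes the bound uniform in \<open>b\<close>:
  being \<open>b * mob b z + (1 - b)\<close>, it splits the function into a term with a factor
  \<open>mob\<close> and a term with a factor \<open>1 - b\<close>, and both kinds have bounded
  densities.\<close>

lemma circle_density_cay:
  assumes \<alpha>: "\<alpha> > 0"
  shows "\<exists>c\<ge>0. \<forall>b cs. 0 \<le> b \<longrightarrow> b < 1 \<longrightarrow> length cs \<le> N \<longrightarrow> (\<forall>x\<in>set cs. cmod x \<le> 1) \<longrightarrow>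
    circle_density \<alpha> c (\<lambda>z. cay b z * (\<Prod>x\<leftarrow>cs. cay b z - x) * ckernel \<alpha> (of_real b) z)"
proof -
  let ?g = "\<lambda>i (b :: real) cs z. of_real (if i = 0 then 1 - b else 1) * mob b z ^ i *
      (\<Prod>x\<leftarrow>cs. of_real b * mob b z + of_real (1 - b) - x) * ckernel \<alpha> (of_real b) z"
  obtain c where c: "c \<ge> 0" "\<And>(b :: real) cs. \<lbrakk>0 \<le> b; b < 1; length cs \<le> N; \<forall>x\<in>set cs. cmod x \<le> 1\<rbrakk> \<Longrightarrow> circle_density \<alpha> c (?g 0 b cs)"
    using circle_density_roots[OF \<alpha>, of N 0] by auto
  obtain c' where c': "c' \<ge> 0" "\<And>(b :: real) cs. \<lbrakk>0 \<le> b; b < 1; length cs \<le> N; \<forall>x\<in>set cs. cmod x \<le> 1\<rbrakk> \<Longrightarrow> circle_density \<alpha> c' (?g 1 b cs)"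
    using circle_density_roots[OF \<alpha>, of N 1] by auto
  show ?thesis
  proof (intro exI[of _ "c' + c"] conjI allI impI)
    fix b :: real and cs assume b: "0 \<le> b" "b < 1" and cs: "length cs \<le> N" "\<forall>x\<in>set cs. cmod x \<le> 1"
    have ne: "1 - of_real b * z \<noteq> 0" if "cmod z < 1" for z
      using kernel_not_nonpos'[of "of_real b" z] b that by auto
    have "circle_density \<alpha> (cmod (of_real b) * c' + c) (\<lambda>z. of_real b * ?g 1 b cs z + ?g 0 b cs z)"
      using \<alpha> b cs c(2) c'(2) by (intro circle_density_add circle_density_scale) auto
    then show "circle_density \<alpha> (c' + c) (\<lambda>z. cay b z * (\<Prod>x\<leftarrow>cs. cay b z - x) * ckernel \<alpha> (of_real b) z)"
    proof (rule circle_density_cong)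
      fix z :: complex assume "cmod z < 1"
      then show "of_real b * ?g 1 b cs z + ?g 0 b cs z = cay b z * (\<Prod>x\<leftarrow>cs. cay b z - x) * ckernel \<alpha> (of_real b) z"
        by (simp add: cay_eq_mob[OF ne] algebra_simps)
    qed (use b c' in \<open>auto intro: mult_left_le_one_le\<close>)
  qed (use c c' in auto)
qed

section \<open>Functions localised at one point of the sequence\<close>

lemma norm_prod_list_map_ge:
  fixes f :: "'a \<Rightarrow> complex"
  assumes "\<And>x. x \<in> set xs \<Longrightarrow> m \<le> cmod (f x)" "0 \<le> m"
  shows "m ^ length xs \<le> cmod (prod_list (map f xs))"
  using assms by (induction xs) (auto simp: norm_mult intro!: mult_mono)

lemma norm_prod_list_map_le:
  fixes f :: "'a \<Rightarrow> complex"
  assumes "\<And>x. x \<in> set xs \<Longrightarrow> cmod (f x) \<le> m" "0 \<le> m"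
  shows "cmod (prod_list (map f xs)) \<le> m ^ length xs"
  using assms by (induction xs) (auto simp: norm_mult intro!: mult_mono)

lemma prod_list_replicate: "prod_list (replicate n (x :: 'a :: monoid_mult)) = x ^ n"
  by (induction n) auto

context nc_stoltz
begin

lemma \<delta>_le_1: "\<delta> \<le> 1"
  using nc[of 0 0] by simp

text \<open>A real point at the same scale \<open>d n\<close> as \<open>a n\<close>. Halving gives
  \<open>\<beta> n \<ge> 1 / 2\<close> even when \<open>d n = 1\<close>, so the factor
  \<open>\<beta> n\<close> in \<open>1 - s\<close> costs only a constant.\<close>

definition \<beta> where "\<beta> n = 1 - d n / 2"

lemma \<beta>_bounds: "1 / 2 \<le> \<beta> n" "\<beta> n < 1" "0 \<le> \<beta> n"
  using d_pos[of n] d_le_1[of n] by (auto simp: \<beta>_def)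

abbreviation s where "s n k \<equiv> cay (\<beta> n) (a k)"

abbreviation den where "den n k \<equiv> cmod (1 - of_real (\<beta> n) * a k)"

text \<open>With \<open>den_le\<close> this makes \<open>den n k\<close> comparable to
  \<open>max (d n) (d k)\<close>. Up to constants, \<open>s\<close> thus has the size of
  \<open>d n / max (d n) (d k)\<close> and \<open>1 - s\<close> that of
  \<open>d k / max (d n) (d k)\<close>.\<close>

lemma den_ge: "d k \<le> den n k" "d n / 2 \<le> den n k" and den_pos: "den n k > 0"
proof -
  have "\<beta> n * cmod (a k) \<le> 1 * cmod (a k)" "\<beta> n * cmod (a k) \<le> \<beta> n * 1"
    using \<beta>_bounds[of n] disc[of k] by (intro mult_right_mono mult_left_mono; simp)+
  moreover have "1 - \<beta> n * cmod (a k) \<le> den n k"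
    using norm_triangle_ineq2[of 1 "of_real (\<beta> n) * a k"] \<beta>_bounds[of n] by (simp add: norm_mult)
  moreover have "d k = 1 - cmod (a k)" "d n / 2 = 1 - \<beta> n" by (auto simp: d_def \<beta>_def)
  ultimately show "d k \<le> den n k" "d n / 2 \<le> den n k" by linarith+
  then show "den n k > 0" using d_pos[of k] by linarith
qed

lemma den_nz: "1 - of_real (\<beta> n) * a k \<noteq> 0"
  using den_pos[of n k] by auto

lemma den_le: "den n k \<le> C * (d k + d n)"
proof -
  have "1 - of_real (\<beta> n) * a k = (1 - a k) + of_real (d n / 2) * a k"
    by (simp add: \<beta>_def algebra_simps)
  also have "cmod \<dots> \<le> cmod (1 - a k) + cmod (of_real (d n / 2) * a k)" by (rule norm_triangle_ineq)
  also have "\<dots> \<le> C * d k + d n"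
  proof -
    have "cmod (of_real (d n / 2) * a k) \<le> d n * 1"
      using d_pos[of n] disc[of k] unfolding norm_mult norm_of_real by (intro mult_mono) auto
    then show ?thesis using stolz_d[of k] by linarith
  qed
  also have "\<dots> \<le> C * (d k + d n)"
    using C_ge_1 d_pos[of n] mult_right_mono[of 1 C "d n"] by (simp add: algebra_simps)
  finally show ?thesis .
qed

lemma cmod_s: "cmod (s n k) = d n / 2 / den n k"
proof -
  have eq: "1 - \<beta> n = d n / 2" by (simp add: \<beta>_def)
  show ?thesis unfolding cay_def norm_divide norm_of_real eq using d_pos[of n] by simp
qed

lemma one_minus_s: "1 - s n k = of_real (\<beta> n) * ((1 - a k) / (1 - of_real (\<beta> n) * a k))"
  using den_nz[of n k] by (simp add: cay_def field_simps)

lemma s_le_1: "cmod (s n k) \<le> 1"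
  unfolding cmod_s using den_ge[of n k] den_pos[of n k] by simp

lemma cmod_quotient_le: "cmod ((1 - a k) / (1 - of_real (\<beta> n) * a k)) \<le> C"
proof -
  have "cmod (1 - a k) \<le> C * den n k"
    using stolz_d[of k] mult_left_mono[OF den_ge(1)[of k n], of C] C_ge_1 by linarith
  then show ?thesis using den_pos[of n k] by (simp add: norm_divide pos_divide_le_eq)
qed

lemma cmod_quotient_ge: "1 / (2 * C) \<le> cmod ((1 - a n) / (1 - of_real (\<beta> n) * a n))"
proof -
  have "den n n \<le> 2 * C * d n" using den_le[of n n] by simp
  also have "\<dots> \<le> 2 * C * cmod (1 - a n)" using C_ge_1 by (intro mult_left_mono d_le) auto
  finally have "den n n \<le> 2 * C * cmod (1 - a n)" .
  then show ?thesis using den_pos[of n n] C_ge_1 by (simp add: norm_divide field_simps)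
qed

lemma s_one_minus_s_ge: "1 / (16 * C\<^sup>2) \<le> cmod (s n n * (s n n - 1))"
proof -
  have "den n n \<le> 2 * C * d n" using den_le[of n n] by simp
  then have 1: "1 / (4 * C) \<le> cmod (s n n)"
    unfolding cmod_s using den_pos[of n n] C_ge_1 by (simp add: field_simps)
  have 2: "1 / (4 * C) \<le> cmod (1 - s n n)"
  proof -
    have "1 / 2 * (1 / (2 * C)) \<le> \<beta> n * cmod ((1 - a n) / (1 - of_real (\<beta> n) * a n))"
      using \<beta>_bounds[of n] cmod_quotient_ge[of n] C_ge_1 by (intro mult_mono) auto
    then show ?thesis using \<beta>_bounds[of n] unfolding one_minus_s norm_mult by simp
  qed
  have "1 / (4 * C) * (1 / (4 * C)) \<le> cmod (s n n) * cmod (1 - s n n)"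
    using 1 2 C_ge_1 by (intro mult_mono) auto
  then show ?thesis by (simp add: norm_mult norm_minus_commute power2_eq_square)
qed

text \<open>The difference of two values of a Moebius map factorises. The \<open>max\<close> in the
  separation of \<open>a n\<close> and \<open>a j\<close> cancels against \<open>den n j\<close>,
  and \<open>d n\<close> against \<open>den n n\<close>; only a constant is left.\<close>

lemma s_separation:
  assumes "j \<noteq> n"
  shows "\<delta> / (16 * C\<^sup>2) \<le> cmod (s n n - s n j)"
proof -
  let ?m = "max (d n) (d j)"
  have eq: "s n n - s n j = of_real (d n / 2) * of_real (\<beta> n) * (a n - a j)
      / ((1 - of_real (\<beta> n) * a n) * (1 - of_real (\<beta> n) * a j))"
  proof -
    have "1 - \<beta> n = d n / 2" by (simp add: \<beta>_def)
    then have "s n n - s n j = (of_real (d n / 2) * (1 - of_real (\<beta> n) * a j) - of_real (d n / 2) * (1 - of_real (\<beta> n) * a n))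
        / ((1 - of_real (\<beta> n) * a n) * (1 - of_real (\<beta> n) * a j))"
      unfolding cay_def by (simp only: diff_frac_eq[OF den_nz den_nz])
    also have "of_real (d n / 2) * (1 - of_real (\<beta> n) * a j) - of_real (d n / 2) * (1 - of_real (\<beta> n) * a n)
        = of_real (d n / 2) * of_real (\<beta> n) * (a n - a j)"
      by (simp add: algebra_simps)
    finally show ?thesis .
  qed
  have "C * (d j + d n) \<le> C * (2 * ?m)" using C_ge_1 by (intro mult_left_mono) auto
  then have "den n j \<le> C * (2 * ?m)" using den_le[of n j] by linarith
  then have "den n n * den n j \<le> (C * (2 * d n)) * (C * (2 * ?m))"
    using den_le[of n n] den_pos[of n n] den_pos[of n j] d_pos[of n] C_ge_1
    by (intro mult_mono) auto
  then have "\<delta> / (16 * C\<^sup>2) * (den n n * den n j) \<le> \<delta> / (16 * C\<^sup>2) * ((C * (2 * d n)) * (C * (2 * ?m)))"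
    using \<delta> by (intro mult_left_mono) auto
  also have "\<dots> = d n / 2 * (1 / 2) * (\<delta> * ?m)"
    using C_ge_1 by (simp add: power2_eq_square field_simps)
  also have "\<dots> \<le> d n / 2 * \<beta> n * cmod (a n - a j)"
    using d_pos[of n] \<beta>_bounds[of n] separation[of n j] assms \<delta>
    by (intro mult_mono) (auto simp: le_max_iff_disj)
  finally have "\<delta> / (16 * C\<^sup>2) \<le> d n / 2 * \<beta> n * cmod (a n - a j) / (den n n * den n j)"
    using den_pos[of n n] den_pos[of n j] by (simp add: pos_le_divide_eq)
  then show ?thesis
    unfolding eq norm_divide norm_mult norm_of_real using d_pos[of n] \<beta>_bounds[of n] by simp
qed

definition gap where "gap n k = (if k < n then n - k else k - n)" for n k :: nat

text \<open>\<open>s\<close> and \<open>1 - s\<close> decay in opposite directions: for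
  \<open>k < n\<close> the first is of the order \<open>d n / d k\<close>, otherwise the second is
  of the order \<open>d k / d n\<close>, and the remaining factor is bounded.\<close>

lemma s_one_minus_s_le:
  assumes K: "1 \<le> K" and q: "0 < q" and geo: "\<And>n m. d (n + m) \<le> K * q ^ m * d n"
  shows "cmod (s n k * (s n k - 1)) \<le> 2 * C * K * q ^ gap n k"
proof (cases "k < n")
  case True
  have "d n \<le> K * q ^ gap n k * d k" using geo[of k "n - k"] True by (simp add: gap_def)
  also have "\<dots> \<le> K * q ^ gap n k * den n k" using K q den_ge(1) by (intro mult_left_mono) auto
  finally have "cmod (s n k) \<le> K * q ^ gap n k"
    unfolding cmod_s using den_pos[of n k] d_pos[of n] by (simp add: pos_divide_le_eq)
  moreover have "cmod (1 - s n k) \<le> C"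
    using mult_mono[of "\<beta> n" 1 "cmod ((1 - a k) / (1 - of_real (\<beta> n) * a k))" C] \<beta>_bounds[of n] cmod_quotient_le[of k n]
    unfolding one_minus_s norm_mult by simp
  ultimately have "cmod (s n k) * cmod (1 - s n k) \<le> K * q ^ gap n k * C"
    using K q by (intro mult_mono) auto
  also have "\<dots> \<le> 2 * C * K * q ^ gap n k" using K q C_ge_1 by simp
  finally show ?thesis by (simp add: norm_mult norm_minus_commute)
next
  case False
  have "d k \<le> K * q ^ gap n k * d n" using geo[of n "k - n"] False by (simp add: gap_def)
  also have "\<dots> \<le> K * q ^ gap n k * (2 * den n k)"
    using K q den_ge(2)[of n k] by (intro mult_left_mono) auto
  finally have "C * d k \<le> C * (K * q ^ gap n k * (2 * den n k))"
    using C_ge_1 by (intro mult_left_mono) auto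
  then have "cmod (1 - a k) \<le> (2 * C * K * q ^ gap n k) * den n k"
    using stolz_d[of k] by (simp add: mult_ac)
  then have "cmod ((1 - a k) / (1 - of_real (\<beta> n) * a k)) \<le> 2 * C * K * q ^ gap n k"
    using den_pos[of n k] by (simp add: norm_divide pos_divide_le_eq)
  then have "\<beta> n * cmod ((1 - a k) / (1 - of_real (\<beta> n) * a k)) \<le> 1 * (2 * C * K * q ^ gap n k)"
    using \<beta>_bounds[of n] by (intro mult_mono) auto
  then have "cmod (1 - s n k) \<le> 2 * C * K * q ^ gap n k"
    unfolding one_minus_s norm_mult using \<beta>_bounds[of n] by simp
  then have "cmod (s n k) * cmod (1 - s n k) \<le> 1 * (2 * C * K * q ^ gap n k)"
    using s_le_1[of n k] by (intro mult_mono) auto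
  then show ?thesis by (simp add: norm_mult norm_minus_commute)
qed

lemma sum_gap_le:
  fixes r :: real
  assumes r: "0 \<le> r" "r < 1"
  shows "(\<Sum>k<N. r ^ gap n k) \<le> 2 / (1 - r)"
proof -
  have "(\<Sum>k<N. r ^ gap n k) \<le> (\<Sum>k\<in>{..<n} \<union> {n..<N}. r ^ gap n k)"
    using r by (intro sum_mono2) auto
  also have "\<dots> = (\<Sum>k<n. r ^ gap n k) + (\<Sum>k\<in>{n..<N}. r ^ gap n k)"
    by (subst sum.union_disjoint) auto
  also have "(\<Sum>k<n. r ^ gap n k) \<le> (\<Sum>k<n. r ^ (n - 1 - k))"
    using r by (intro sum_mono) (auto simp: gap_def intro!: power_decreasing)
  also have "\<dots> \<le> 1 / (1 - r)" by (rule sum_power_below_le[OF r])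
  also have "(\<Sum>k\<in>{n..<N}. r ^ gap n k) = (\<Sum>k\<in>{n..<N}. r ^ (k - n))"
    by (intro sum.cong) (auto simp: gap_def)
  also have "\<dots> \<le> 1 / (1 - r)" by (rule sum_power_above_le[OF r])
  finally show ?thesis by simp
qed

section \<open>Prescribed zeros and the size of the localised functions\<close>

definition near where "near R n = filter (\<lambda>j. j \<noteq> n) [n - R..<n + R + 1]" for R n :: nat

lemma length_near: "length (near R n) \<le> 2 * R + 1"
proof -
  have "n + R + 1 - (n - R) \<le> 2 * R + 1" by arith
  then show ?thesis unfolding near_def by (intro order_trans[OF length_filter_le]) (simp only: length_upt)
qed

lemma set_near: "set (near R n) = {j. j \<noteq> n \<and> gap n j \<le> R}"
  by (auto simp: near_def gap_def)

text \<open>The multiplicity at 0 is \<open>2 * E - 1\<close> because the leading factor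
  \<open>cay\<close> of \<open>circle_density_cay\<close> supplies the last one.\<close>

definition roots where
  "roots E R n = replicate (2 * E - 1) 0 @ replicate (2 * E) 1 @ map (s n) (near R n)"

lemma roots_prod:
  assumes "E > 0"
  shows "z * (\<Prod>x\<leftarrow>roots E R n. z - x) = (z * (z - 1)) ^ (2 * E) * (\<Prod>j\<leftarrow>near R n. z - s n j)"
proof -
  have "z * z ^ (2 * E - 1) = z ^ (2 * E)" using assms by (cases E) auto
  then show ?thesis
    by (simp add: roots_def prod_list_replicate o_def power_mult_distrib mult.assoc[symmetric])
qed

text \<open>\<open>\<Lambda>\<close> is the price of one nearby root: the bound 2 for its factor at
  \<open>a k\<close>, divided by the lower bound \<open>\<delta> / (16 * C^2)\<close> at
  \<open>a n\<close>. \<open>V\<close> is the product of the lower bounds at \<open>a n\<close>, and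
  \<open>A\<close> collects what does not depend on \<open>R\<close>, so that \<open>R\<close> can
  be chosen last.\<close>

lemma localized_estimate:
  fixes R :: nat
  assumes K: "1 \<le> K" and q: "0 < q" "q < 1" and geo: "\<And>n m. d (n + m) \<le> K * q ^ m * d n"
    and E: "E > 0"
  defines "p \<equiv> \<lambda>n k. (1 - a k) powr of_real \<alpha> *
    (s n k * (\<Prod>x\<leftarrow>roots E R n. s n k - x) * ckernel \<alpha> (of_real (\<beta> n)) (a k))"
  defines "\<Lambda> \<equiv> 32 * C\<^sup>2 / \<delta>"
  defines "V \<equiv> (1 / (2 * C)) powr \<alpha> * (1 / (16 * C\<^sup>2)) ^ (2 * E) * (\<delta> / (16 * C\<^sup>2)) ^ (2 * R + 1)"
  defines "A \<equiv> (2 * C\<^sup>2) powr \<alpha> * (32 * C ^ 3 * K) ^ (2 * E) * \<Lambda>"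
  shows "V \<le> cmod (p n n)" "V > 0"
    and "k \<noteq> n \<Longrightarrow> cmod (p n k / p n n) \<le> A * (\<Lambda>\<^sup>2 * q ^ E) ^ R * (q ^ E) ^ gap n k"
proof -
  define P where "P k = (\<Prod>j\<leftarrow>near R n. s n k - s n j)" for k
  define w where "w k = (1 - a k) / (1 - of_real (\<beta> n) * a k)" for k
  have p_eq: "p n k = w k powr of_real \<alpha> * ((s n k * (s n k - 1)) ^ (2 * E) * P k)" for k
  proof -
    have "cmod (of_real (\<beta> n) * a k) < 1"
      using \<beta>_bounds[of n] disc[of k] mult_left_le_one_le[of "cmod (a k)" "\<beta> n"] by (simp add: norm_mult)
    then have "(1 - a k) powr of_real \<alpha> * ckernel \<alpha> (of_real (\<beta> n)) (a k) = w k powr of_real \<alpha>"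
      using powr_divide_right_half_plane[OF Re_one_minus_pos[OF disc] Re_one_minus_pos]
      by (simp add: ckernel_def w_def)
    moreover have "p n k = ((1 - a k) powr of_real \<alpha> * ckernel \<alpha> (of_real (\<beta> n)) (a k)) * (s n k * (\<Prod>x\<leftarrow>roots E R n. s n k - x))"
      by (simp add: p_def mult_ac)
    ultimately show ?thesis unfolding roots_prod[OF E] P_def by simp
  qed
  have \<sigma>: "0 < \<delta> / (16 * C\<^sup>2)" "\<delta> / (16 * C\<^sup>2) \<le> 1"
  proof -
    have "1 * 1 \<le> C * C" using C_ge_1 by (intro mult_mono) auto
    then have "\<delta> \<le> 16 * C\<^sup>2" using \<delta>_le_1 by (simp add: power2_eq_square)
    then show "0 < \<delta> / (16 * C\<^sup>2)" "\<delta> / (16 * C\<^sup>2) \<le> 1" using \<delta> C_ge_1 by (auto simp: divide_le_eq)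
  qed
  show V: "V > 0" using C_ge_1 \<sigma> \<delta> by (simp add: V_def)
  have Pn: "(\<delta> / (16 * C\<^sup>2)) ^ (2 * R + 1) \<le> cmod (P n)"
  proof -
    have "(\<delta> / (16 * C\<^sup>2)) ^ (2 * R + 1) \<le> (\<delta> / (16 * C\<^sup>2)) ^ length (near R n)"
      using \<sigma> length_near by (intro power_decreasing) auto
    also have "\<dots> \<le> cmod (P n)"
      unfolding P_def using s_separation \<sigma> by (intro norm_prod_list_map_ge) (auto simp: set_near)
    finally show ?thesis .
  qed
  have Pk: "cmod (P k) \<le> 2 ^ (2 * R + 1)" for k
  proof -
    have "cmod (s n k - s n j) \<le> 2" for j
      using norm_triangle_ineq4[of "s n k" "s n j"] s_le_1[of n k] s_le_1[of n j] by linarith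
    then have "cmod (P k) \<le> 2 ^ length (near R n)"
      unfolding P_def by (intro norm_prod_list_map_le) auto
    also have "\<dots> \<le> 2 ^ (2 * R + 1)" using length_near by (intro power_increasing) auto
    finally show ?thesis .
  qed
  have wn: "(1 / (2 * C)) powr \<alpha> \<le> cmod (w n) powr \<alpha>"
    using cmod_quotient_ge[of n] C_ge_1 \<alpha> by (intro powr_mono2) (auto simp: w_def)
  have wk: "cmod (w k) powr \<alpha> \<le> C powr \<alpha>" for k
    using cmod_quotient_le[of k n] \<alpha> by (intro powr_mono2) (auto simp: w_def)
  have "V \<le> cmod (w n) powr \<alpha> * cmod (s n n * (s n n - 1)) ^ (2 * E) * cmod (P n)"
    unfolding V_def using wn s_one_minus_s_ge[of n] Pn \<sigma> \<delta> by (intro mult_mono power_mono) auto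
  then show Vp: "V \<le> cmod (p n n)"
    unfolding p_eq norm_mult norm_power cmod_powr_of_real by (simp add: mult.assoc)
  assume "k \<noteq> n"
  show "cmod (p n k / p n n) \<le> A * (\<Lambda>\<^sup>2 * q ^ E) ^ R * (q ^ E) ^ gap n k"
  proof (cases "gap n k \<le> R")
    case True
    then have "k \<in> set (near R n)" using \<open>k \<noteq> n\<close> by (simp add: set_near)
    then have "P k = 0" by (force simp: P_def prod_list_zero_iff)
    then show ?thesis
      unfolding p_eq using C_ge_1 \<delta> K q by (simp add: A_def \<Lambda>_def)
  next
    case False
    have "cmod (p n k) \<le> C powr \<alpha> * ((2 * C * K * q ^ gap n k) ^ (2 * E) * 2 ^ (2 * R + 1))"
      unfolding p_eq norm_mult[of "w k powr _"] norm_mult[of "_ ^ _"] norm_power cmod_powr_of_real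
      using wk Pk s_one_minus_s_le[OF K q(1) geo] C_ge_1 K q by (intro mult_mono power_mono) auto
    then have "cmod (p n k / p n n) \<le> C powr \<alpha> * ((2 * C * K * q ^ gap n k) ^ (2 * E) * 2 ^ (2 * R + 1)) / V"
      unfolding norm_divide using V Vp C_ge_1 K q by (intro frac_le) auto
    also have "\<dots> = A * \<Lambda>\<^sup>2 ^ R * (q ^ gap n k) ^ (2 * E)"
    proof -
      have 1: "C powr \<alpha> / (1 / (2 * C)) powr \<alpha> = (2 * C\<^sup>2) powr \<alpha>"
        using C_ge_1 by (simp add: powr_divide powr_mult power2_eq_square)
      have 2: "(2 * C * K * q ^ gap n k) ^ (2 * E) / (1 / (16 * C\<^sup>2)) ^ (2 * E) = (32 * C ^ 3 * K) ^ (2 * E) * (q ^ gap n k) ^ (2 * E)"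
        unfolding power_divide[symmetric] power_mult_distrib[symmetric]
        by (simp add: power2_eq_square power3_eq_cube mult_ac)
      have 3: "2 ^ (2 * R + 1) / (\<delta> / (16 * C\<^sup>2)) ^ (2 * R + 1) = \<Lambda> * \<Lambda>\<^sup>2 ^ R"
        unfolding power_divide[symmetric] power_mult[symmetric] by (simp add: \<Lambda>_def)
      have "C powr \<alpha> * ((2 * C * K * q ^ gap n k) ^ (2 * E) * 2 ^ (2 * R + 1)) / V
          = (C powr \<alpha> / (1 / (2 * C)) powr \<alpha>) * ((2 * C * K * q ^ gap n k) ^ (2 * E) / (1 / (16 * C\<^sup>2)) ^ (2 * E))
            * (2 ^ (2 * R + 1) / (\<delta> / (16 * C\<^sup>2)) ^ (2 * R + 1))"
        unfolding V_def times_divide_times_eq by (simp only: mult.assoc)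
      also have "\<dots> = A * \<Lambda>\<^sup>2 ^ R * (q ^ gap n k) ^ (2 * E)"
        unfolding 1 2 3 A_def by (simp only: mult_ac)
      finally show ?thesis .
    qed
    \<comment> \<open>The decay is halved: since \<open>gap n k > R\<close>, one half is traded for
      \<open>(q ^ E) ^ R\<close>, which offsets the power of \<open>\<Lambda>\<close> that grows
      with \<open>R\<close>; the other half remains for the summation over \<open>k\<close>.\<close>
    also have "(q ^ gap n k) ^ (2 * E) = (q ^ E) ^ gap n k * (q ^ E) ^ gap n k"
      by (simp add: power_mult[symmetric] power_add[symmetric] algebra_simps mult_2)
    also have "A * \<Lambda>\<^sup>2 ^ R * ((q ^ E) ^ gap n k * (q ^ E) ^ gap n k) \<le> A * \<Lambda>\<^sup>2 ^ R * ((q ^ E) ^ R * (q ^ E) ^ gap n k)"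
      using False q C_ge_1 \<delta> K
      by (intro mult_left_mono mult_right_mono power_decreasing) (auto simp: A_def \<Lambda>_def power_le_one)
    also have "\<dots> = A * (\<Lambda>\<^sup>2 * q ^ E) ^ R * (q ^ E) ^ gap n k"
      by (simp add: power_mult_distrib mult_ac)
    finally show ?thesis .
  qed
qed

lemma localized_functions:
  "\<exists>B g. \<forall>n. circle_density \<alpha> B (g n) \<and> (1 - a n) powr of_real \<alpha> * g n (a n) = 1 \<and>
     (\<forall>N. (\<Sum>k\<in>{..<N} - {n}. cmod ((1 - a k) powr of_real \<alpha> * g n (a k))) \<le> 1 / 2)"
proof -
  obtain K q where K: "1 \<le> K" and q: "0 < q" "q < 1" and geo: "\<And>n m. d (n + m) \<le> K * q ^ m * d n"
    using d_geometric by blast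
  define \<Lambda> where "\<Lambda> = 32 * C\<^sup>2 / \<delta>"
  have \<Lambda>: "\<Lambda> > 0" using C_ge_1 \<delta> by (simp add: \<Lambda>_def)
  \<comment> \<open>\<open>E\<close> depends on \<open>\<Lambda>\<close> and \<open>q\<close> only:
    raising \<open>R\<close> by one has to gain a factor 1/2 in spite of two more factors
    \<open>\<Lambda>\<close>.\<close>
  obtain E0 where E0: "q ^ E0 < 1 / (2 * \<Lambda>\<^sup>2)"
    using real_arch_pow_inv[of "1 / (2 * \<Lambda>\<^sup>2)" q] q \<Lambda> by auto
  define E where "E = Suc E0"
  have E: "E > 0" by (simp add: E_def)
  have "q ^ E \<le> q ^ E0" using q by (simp add: E_def mult_left_le_one_le)
  then have half: "\<Lambda>\<^sup>2 * q ^ E \<le> 1 / 2"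
  proof -
    have "q ^ E \<le> 1 / (2 * \<Lambda>\<^sup>2)" using E0 \<open>q ^ E \<le> q ^ E0\<close> by linarith
    then show ?thesis using \<Lambda> by (simp add: field_simps)
  qed
  have r: "0 < q ^ E" "q ^ E < 1" using q E by (auto simp: power_less_one_iff)
  define A where "A = (2 * C\<^sup>2) powr \<alpha> * (32 * C ^ 3 * K) ^ (2 * E) * \<Lambda>"
  have A: "A > 0" using C_ge_1 K \<Lambda> by (simp add: A_def)
  \<comment> \<open>The sum over the gaps costs \<open>2 / (1 - q ^ E)\<close>, so this choice
    leaves 1/2 for all off-diagonal values together.\<close>
  obtain R where R: "(1 / 2) ^ R < (1 - q ^ E) / (4 * A)"
    using real_arch_pow_inv[of "(1 - q ^ E) / (4 * A)" "1 / 2"] r A by auto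
  define V where "V = (1 / (2 * C)) powr \<alpha> * (1 / (16 * C\<^sup>2)) ^ (2 * E) * (\<delta> / (16 * C\<^sup>2)) ^ (2 * R + 1)"
  define h where "h n z = cay (\<beta> n) z * (\<Prod>x\<leftarrow>roots E R n. cay (\<beta> n) z - x) * ckernel \<alpha> (of_real (\<beta> n)) z" for n z
  define p where "p n k = (1 - a k) powr of_real \<alpha> * h n (a k)" for n k
  have est: "V \<le> cmod (p n n)" "V > 0"
      "k \<noteq> n \<Longrightarrow> cmod (p n k / p n n) \<le> A * (\<Lambda>\<^sup>2 * q ^ E) ^ R * (q ^ E) ^ gap n k" for n k
    unfolding p_def h_def V_def A_def \<Lambda>_def by (rule localized_estimate[OF K q geo E])+
  have len: "length (roots E R n) \<le> 4 * E + (2 * R + 1)" for n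
    using length_near[of R n] by (simp add: roots_def)
  obtain c where c: "c \<ge> 0" "\<And>b cs. \<lbrakk>0 \<le> b; b < 1; length cs \<le> 4 * E + (2 * R + 1); \<forall>x\<in>set cs. cmod x \<le> 1\<rbrakk> \<Longrightarrow>
    circle_density \<alpha> c (\<lambda>z. cay b z * (\<Prod>x\<leftarrow>cs. cay b z - x) * ckernel \<alpha> (of_real b) z)"
    using circle_density_cay[OF \<alpha>] by blast
  have dens: "circle_density \<alpha> c (h n)" for n
    unfolding h_def using \<beta>_bounds[of n] len s_le_1 by (intro c(2)) (auto simp: roots_def)
  define g where "g n z = (1 / p n n) * h n z" for n z
  have pn: "p n n \<noteq> 0" for n using est(1)[of n] est(2) by auto
  have g_eq: "(1 - a k) powr of_real \<alpha> * g n (a k) = p n k / p n n" for n k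
    by (simp add: g_def p_def)
  show ?thesis
  proof (intro exI[of _ "1 / V * c"] exI[of _ g] allI conjI)
    fix n N
    have "cmod (1 / p n n) \<le> 1 / V"
      using est(1)[of n] est(2) by (simp add: norm_divide frac_le)
    then have "cmod (1 / p n n) * c \<le> 1 / V * c" using c(1) by (rule mult_right_mono)
    then show "circle_density \<alpha> (1 / V * c) (g n)"
      unfolding g_def by (intro circle_density_cong[OF circle_density_scale[OF dens]]) auto
    show "(1 - a n) powr of_real \<alpha> * g n (a n) = 1"
      unfolding g_eq using pn by simp
    have "(\<Sum>k\<in>{..<N} - {n}. cmod ((1 - a k) powr of_real \<alpha> * g n (a k)))
        \<le> (\<Sum>k\<in>{..<N} - {n}. A * (1 / 2) ^ R * (q ^ E) ^ gap n k)"
      unfolding g_eq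
    proof (rule sum_mono)
      fix k assume "k \<in> {..<N} - {n}"
      then have "cmod (p n k / p n n) \<le> A * (\<Lambda>\<^sup>2 * q ^ E) ^ R * (q ^ E) ^ gap n k" by (intro est) auto
      also have "\<dots> \<le> A * (1 / 2) ^ R * (q ^ E) ^ gap n k"
        using half A r \<Lambda> by (intro mult_right_mono mult_left_mono power_mono) auto
      finally show "cmod (p n k / p n n) \<le> A * (1 / 2) ^ R * (q ^ E) ^ gap n k" .
    qed
    also have "\<dots> \<le> (\<Sum>k<N. A * (1 / 2) ^ R * (q ^ E) ^ gap n k)"
      using A r by (intro sum_mono2) auto
    also have "\<dots> = A * (1 / 2) ^ R * (\<Sum>k<N. (q ^ E) ^ gap n k)" by (simp add: sum_distrib_left)
    also have "\<dots> \<le> A * (1 / 2) ^ R * (2 / (1 - q ^ E))"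
      using A r by (intro mult_left_mono sum_gap_le) auto
    also have "\<dots> \<le> A * ((1 - q ^ E) / (4 * A)) * (2 / (1 - q ^ E))"
      using A r R by (intro mult_right_mono mult_left_mono) auto
    also have "\<dots> = 1 / 2" using A r by simp
    finally show "(\<Sum>k\<in>{..<N} - {n}. cmod ((1 - a k) powr of_real \<alpha> * g n (a k))) \<le> 1 / 2" .
  qed
qed

end

section \<open>Interpolation\<close>

text \<open>The \<open>n\<close>-th unit vector is sent to the row \<open>E n\<close>, so a common
  bound for the l1 norms of the rows bounds the operator on l1.\<close>

lemma l1_operator:
  fixes c :: "nat \<Rightarrow> complex" and E :: "nat \<Rightarrow> nat \<Rightarrow> complex"
  assumes c: "summable (\<lambda>n. cmod (c n))" and E: "\<And>n N. (\<Sum>k<N. cmod (E n k)) \<le> B"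
  shows "summable (\<lambda>n. cmod (c n * E n k))"
    and "(\<Sum>k<N. cmod (\<Sum>n. c n * E n k)) \<le> B * (\<Sum>n. cmod (c n))"
proof -
  have Ek: "cmod (E n k) \<le> B" for n k
  proof -
    have "cmod (E n k) \<le> (\<Sum>k<Suc k. cmod (E n k))" by (simp add: sum_nonneg)
    then show ?thesis using E order_trans by blast
  qed
  have sm: "summable (\<lambda>n. cmod (c n * E n k))" for k
  proof (rule summable_comparison_test'[where N = 0])
    show "summable (\<lambda>n. cmod (c n) * B)" using c by (rule summable_mult2)
    show "norm (cmod (c n * E n k)) \<le> cmod (c n) * B" for n
      using Ek by (simp add: norm_mult mult_left_mono)
  qed
  then show "summable (\<lambda>n. cmod (c n * E n k))" .
  have "(\<Sum>k<N. cmod (\<Sum>n. c n * E n k)) \<le> (\<Sum>k<N. \<Sum>n. cmod (c n * E n k))"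
    by (intro sum_mono summable_norm sm)
  also have "\<dots> = (\<Sum>n. \<Sum>k<N. cmod (c n * E n k))"
    by (intro suminf_sum[symmetric] sm)
  also have "\<dots> \<le> (\<Sum>n. B * cmod (c n))"
  proof (intro suminf_le summable_sum sm summable_mult c)
    fix n
    have "(\<Sum>k<N. cmod (c n * E n k)) = cmod (c n) * (\<Sum>k<N. cmod (E n k))"
      by (simp add: norm_mult sum_distrib_left)
    also have "\<dots> \<le> cmod (c n) * B" by (intro mult_left_mono E) auto
    finally show "(\<Sum>k<N. cmod (c n * E n k)) \<le> B * cmod (c n)" by (simp add: mult.commute)
  qed
  also have "\<dots> = B * (\<Sum>n. cmod (c n))" using c by (rule suminf_mult)
  finally show "(\<Sum>k<N. cmod (\<Sum>n. c n * E n k)) \<le> B * (\<Sum>n. cmod (c n))" .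
qed

text \<open>The Neumann series converges in \<open>\<ell>\<^sup>1\<close>; Tannery's theorem passes to the limit in its partial sums.\<close>

lemma l1_diagonally_dominant_solve:
  fixes F :: "nat \<Rightarrow> nat \<Rightarrow> complex"
  assumes diag: "\<And>n. F n n = 1" and off: "\<And>n N. (\<Sum>k\<in>{..<N} - {n}. cmod (F n k)) \<le> 1 / 2"
    and y: "summable (\<lambda>k. cmod (y k))"
  shows "\<exists>b. summable (\<lambda>n. cmod (b n)) \<and> (\<forall>k. (\<lambda>n. b n * F n k) sums y k)"
proof -
  define E where "E n k = (if k = n then 0 else F n k)" for n k
  have E: "(\<Sum>k<N. cmod (E n k)) \<le> 1 / 2" for n N
  proof -
    have "(\<Sum>k<N. cmod (E n k)) = (\<Sum>k\<in>{..<N} - {n}. cmod (E n k))"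
      by (rule sum.mono_neutral_right) (auto simp: E_def)
    also have "\<dots> = (\<Sum>k\<in>{..<N} - {n}. cmod (F n k))"
      by (rule sum.cong) (auto simp: E_def)
    finally show ?thesis using off by simp
  qed
  define T where "T c k = (\<Sum>n. c n * E n k)" for c k
  define Y where "Y = (\<Sum>k. cmod (y k))"
  \<comment> \<open>The terms \<open>(- T) ^ j\<close> applied to \<open>y\<close> of the Neumann
    series for \<open>b + T b = y\<close>, with \<open>T\<close> the off-diagonal part.\<close>
  define it where "it j = ((\<lambda>c k. - T c k) ^^ j) y" for j
  have it_0: "it 0 = y" and it_Suc: "it (Suc j) k = - T (it j) k" for j k
    by (simp_all add: it_def)
  have it: "summable (\<lambda>k. cmod (it j k)) \<and> (\<Sum>k. cmod (it j k)) \<le> (1 / 2) ^ j * Y" for j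
  proof (induction j)
    case 0
    then show ?case using y by (simp add: it_0 Y_def)
  next
    case (Suc j)
    have le: "(\<Sum>k<N. cmod (it (Suc j) k)) \<le> 1 / 2 * (\<Sum>k. cmod (it j k))" for N
      using l1_operator(2)[OF conjunct1[OF Suc] E] by (simp add: it_Suc T_def)
    have sm: "summable (\<lambda>k. cmod (it (Suc j) k))"
      by (rule summableI_nonneg_bounded[OF _ le]) auto
    have "(\<Sum>k. cmod (it (Suc j) k)) \<le> 1 / 2 * (\<Sum>k. cmod (it j k))"
      by (rule suminf_le_const[OF sm le])
    also have "\<dots> \<le> (1 / 2) ^ Suc j * Y" using Suc by simp
    finally show ?case using sm by simp
  qed
  have Y: "Y \<ge> 0" unfolding Y_def using y by (intro suminf_nonneg) auto
  have it_le: "cmod (it j k) \<le> (1 / 2) ^ j * Y" for j k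
  proof -
    have "cmod (it j k) = (\<Sum>i\<in>{k}. cmod (it j i))" by simp
    also have "\<dots> \<le> (\<Sum>i. cmod (it j i))" using it by (intro sum_le_suminf) auto
    finally show ?thesis using it[of j] by linarith
  qed
  have smg: "summable (\<lambda>j. (1 / 2) ^ j * Y)" by (intro summable_mult2 summable_geometric) simp
  have smj: "summable (\<lambda>j. cmod (it j k))" for k
    using it_le by (intro summable_comparison_test'[OF smg, of 0]) auto
  define b where "b k = (\<Sum>j. it j k)" for k
  \<comment> \<open>A summable majorant of all partial sums \<open>S J\<close>, the dominating
    sequence for Tannery's theorem.\<close>
  define M where "M k = (\<Sum>j. cmod (it j k))" for k
  have M: "summable M"
  proof (rule summableI_nonneg_bounded)
    show "0 \<le> M k" for k unfolding M_def using smj by (intro suminf_nonneg) auto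
    fix N
    have "(\<Sum>k<N. M k) = (\<Sum>j. \<Sum>k<N. cmod (it j k))"
      unfolding M_def by (intro suminf_sum[symmetric] smj)
    also have "\<dots> \<le> (\<Sum>j. (1 / 2) ^ j * Y)"
    proof (intro suminf_le summable_sum smj smg)
      fix j
      have "(\<Sum>k<N. cmod (it j k)) \<le> (\<Sum>k. cmod (it j k))" using it by (intro sum_le_suminf) auto
      then show "(\<Sum>k<N. cmod (it j k)) \<le> (1 / 2) ^ j * Y" using it[of j] by linarith
    qed
    finally show "(\<Sum>k<N. M k) \<le> (\<Sum>j. (1 / 2) ^ j * Y)" .
  qed
  have b_le: "cmod (b k) \<le> M k" for k
    unfolding b_def M_def by (rule summable_norm[OF smj])
  have smb: "summable (\<lambda>k. cmod (b k))"
    using b_le by (intro summable_comparison_test'[OF M, of 0]) auto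
  define S where "S J k = (\<Sum>j<J. it j k)" for J k
  have S_lim: "(\<lambda>J. S J k) \<longlonglongrightarrow> b k" for k
    unfolding S_def b_def by (rule summable_LIMSEQ[OF summable_norm_cancel[OF smj]])
  have S_le: "cmod (S J k) \<le> M k" for J k
    unfolding S_def M_def using smj
    by (intro order_trans[OF norm_sum] sum_le_suminf) auto
  have sumT: "summable (\<lambda>n. it j n * E n k)" for j k
    using l1_operator(1)[OF conjunct1[OF it] E] by (rule summable_norm_cancel)
  have S_rec: "S (Suc J) k = y k - T (S J) k" for J k
  proof -
    have "T (S J) k = (\<Sum>n. \<Sum>j<J. it j n * E n k)"
      by (simp add: T_def S_def sum_distrib_right)
    also have "\<dots> = (\<Sum>j<J. T (it j) k)"
      unfolding T_def by (rule suminf_sum) (rule sumT)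
    also have "\<dots> = - (\<Sum>j<J. it (Suc j) k)" by (simp add: it_Suc sum_negf)
    finally have "T (S J) k = - (\<Sum>j<J. it (Suc j) k)" .
    moreover have "S (Suc J) k = y k + (\<Sum>j<J. it (Suc j) k)"
      unfolding S_def by (subst sum.lessThan_Suc_shift) (simp add: it_0)
    ultimately show ?thesis by simp
  qed
  have T_lim: "(\<lambda>J. T (S J) k) \<longlonglongrightarrow> T b k" for k
  proof -
    have E1: "cmod (E n k) \<le> 1" for n
    proof -
      have "cmod (E n k) \<le> (\<Sum>k<Suc k. cmod (E n k))" by (simp add: sum_nonneg)
      then show ?thesis using E[of n "Suc k"] by linarith
    qed
    have "eventually (\<lambda>J. summable (\<lambda>n. norm (S J n * E n k))) sequentially \<and> summable (\<lambda>n. norm (b n * E n k)) \<and>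
        (\<lambda>J. \<Sum>n. S J n * E n k) \<longlonglongrightarrow> (\<Sum>n. b n * E n k)"
    proof (rule tannerys_theorem)
      show "\<forall>\<^sub>F (n, J) in sequentially \<times>\<^sub>F sequentially. norm (S J n * E n k) \<le> M n"
      proof (rule always_eventually, clarify)
        fix n J
        have "norm (S J n * E n k) \<le> M n * 1"
          unfolding norm_mult using S_le[of J n] E1[of n] by (intro mult_mono) (auto intro: order_trans[OF norm_ge_zero])
        then show "norm (S J n * E n k) \<le> M n" by simp
      qed
    qed (auto intro!: tendsto_intros S_lim M)
    then show ?thesis by (simp add: T_def)
  qed
  have sol: "b k = y k - T b k" for k
  proof (rule LIMSEQ_unique)
    show "(\<lambda>J. S (Suc J) k) \<longlonglongrightarrow> b k" by (rule LIMSEQ_Suc[OF S_lim])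
    show "(\<lambda>J. S (Suc J) k) \<longlonglongrightarrow> y k - T b k"
      unfolding S_rec by (intro tendsto_intros T_lim)
  qed
  have "(\<lambda>n. b n * F n k) sums y k" for k
  proof -
    have "(\<lambda>n. b n * E n k) sums T b k"
      unfolding T_def using l1_operator(1)[OF smb E] by (intro summable_sums summable_norm_cancel[of "\<lambda>n. b n * E n k"])
    moreover have "(\<lambda>n. if n = k then b k else 0) sums b k" by (rule sums_single)
    ultimately have "(\<lambda>n. b n * E n k + (if n = k then b k else 0)) sums (T b k + b k)" by (rule sums_add)
    moreover have "(\<lambda>n. b n * E n k + (if n = k then b k else 0)) = (\<lambda>n. b n * F n k)"
      by (auto simp: E_def diag fun_eq_iff)
    moreover have "T b k + b k = y k" using sol[of k] by simp
    ultimately show ?thesis by simp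
  qed
  then show ?thesis using smb by blast
qed

text \<open>
  The densities live on \<open>[0, 1]\<close>; the atoms are put on \<open>(1, 2]\<close>, so that one pair of functions on
  \<open>\<nat> \<times> \<real>\<close> carries both.
\<close>

lemma F_space_series:
  assumes \<alpha>: "\<alpha> > 0" and g: "\<And>n. circle_density \<alpha> B (g n)" and b: "summable (\<lambda>n. cmod (b n))"
    and c: "summable (\<lambda>n. cmod (c n))" and \<zeta>: "\<And>n. cmod (\<zeta> n) = 1"
  shows "(\<lambda>z. \<Sum>n. b n * g n z + c n * ckernel \<alpha> (cnj (\<zeta> n)) z) \<in> F_space \<alpha>"
proof -
  have "\<forall>n. \<exists>f :: real \<Rightarrow> complex. integrable lborel f \<and> (\<forall>t. t \<notin> {0..1} \<longrightarrow> f t = 0) \<and>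
     (LINT t|lborel. cmod (f t)) \<le> B \<and>
     (\<forall>z. cmod z < 1 \<longrightarrow> g n z = (LINT t|lborel. f t * ckernel \<alpha> (cis (2 * pi * t)) z))"
    using g unfolding circle_density_def by blast
  from choice[OF this] obtain \<kappa> where \<kappa>: "\<And>n. integrable lborel (\<kappa> n)" "\<And>n t. t \<notin> {0..1} \<Longrightarrow> \<kappa> n t = 0"
    "\<And>n. (LINT t|lborel. cmod (\<kappa> n t)) \<le> B"
    "\<And>n z. cmod z < 1 \<Longrightarrow> g n z = (LINT t|lborel. \<kappa> n t * ckernel \<alpha> (cis (2 * pi * t)) z)"
    by blast
  define ind where "ind t = complex_of_real (indicator {1<..2} t)" for t :: real
  have ind: "integrable lborel ind" "(LINT t|lborel. ind t) = 1" "(LINT t|lborel. cmod (ind t)) = 1"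
    unfolding ind_def norm_of_real integral_complex_of_real by (simp_all add: integrable_of_real)
  \<comment> \<open>The minus sign compensates the conjugate in the kernel, as
    \<open>circle_density\<close> evaluates \<open>ckernel\<close> at
    \<open>cis (2 * pi * t)\<close> itself. Values of \<open>t\<close> outside \<open>[0, 2]\<close>
    carry no mass.\<close>
  define \<phi> where "\<phi> = (\<lambda>(n, t). if t \<le> 1 then cis (- (2 * pi * t)) else \<zeta> n)"
  define f where "f = (\<lambda>(n, t). b n * \<kappa> n t + c n * ind t)"
  define P where "P = count_space (UNIV :: nat set) \<Otimes>\<^sub>M (lborel :: real measure)"
  interpret sigma_finite_measure "count_space (UNIV :: nat set)" by (rule sigma_finite_measure_count_space)
  interpret pair_sigma_finite "count_space (UNIV :: nat set)" "lborel :: real measure" ..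
  have \<phi>_meas: "\<phi> \<in> borel_measurable P"
    unfolding P_def
  proof (rule measurable_pair_measure_countable1)
    have [measurable]: "(\<lambda>t. cis (- (2 * pi * t))) \<in> borel_measurable borel"
      by (intro borel_measurable_continuous_onI continuous_intros)
    show "(\<lambda>t. \<phi> (n, t)) \<in> borel_measurable lborel" for n
      unfolding \<phi>_def by simp
  qed auto
  have f_int: "integrable lborel (\<lambda>t. f (n, t))" for n
    using \<kappa> ind by (simp add: f_def)
  have f_norm: "(LINT t|lborel. cmod (f (n, t))) \<le> cmod (b n) * B + cmod (c n)" for n
  proof -
    have "(LINT t|lborel. cmod (f (n, t))) \<le> (LINT t|lborel. cmod (b n) * cmod (\<kappa> n t) + cmod (c n) * cmod (ind t))"
      using f_int[of n] \<kappa>(1)[of n] ind(1)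
      by (intro integral_mono) (auto simp: f_def norm_mult intro!: order_trans[OF norm_triangle_ineq])
    also have "\<dots> \<le> cmod (b n) * B + cmod (c n)"
      using \<kappa>(1,3)[of n] ind by (simp add: mult_left_mono)
    finally show ?thesis .
  qed
  have f_P: "integrable P f"
    unfolding P_def
  proof (rule Fubini_integrable)
    show "f \<in> borel_measurable (count_space UNIV \<Otimes>\<^sub>M lborel)"
      using f_int by (intro measurable_pair_measure_countable1) auto
    have "summable (\<lambda>n. cmod (b n) * B + cmod (c n))"
      by (intro summable_add summable_mult2 b c)
    then have "summable (\<lambda>n. LINT t|lborel. cmod (f (n, t)))"
      by (rule summable_comparison_test'[where N = 0]) (use f_norm in simp)
    then show "integrable (count_space UNIV) (\<lambda>n. LINT t|lborel. cmod (f (n, t)))"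
      by (simp add: integrable_count_space_nat_iff)
  qed (use f_int in auto)
  have \<phi>_norm: "cmod (\<phi> x) = 1" for x
    using \<zeta> by (cases x) (simp add: \<phi>_def)
  show ?thesis
  proof (rule F_space_pushforward[OF \<alpha> f_P \<phi>_meas \<phi>_norm])
    fix z :: complex assume z: "cmod z < 1"
    have slice: "(LINT t|lborel. f (n, t) * ckernel \<alpha> (cnj (\<phi> (n, t))) z)
        = b n * g n z + c n * ckernel \<alpha> (cnj (\<zeta> n)) z" for n
    proof -
      have "(LINT t|lborel. f (n, t) * ckernel \<alpha> (cnj (\<phi> (n, t))) z)
          = (LINT t|lborel. b n * (\<kappa> n t * ckernel \<alpha> (cis (2 * pi * t)) z)
              + (c n * ckernel \<alpha> (cnj (\<zeta> n)) z) * ind t)"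
        by (intro Bochner_Integration.integral_cong refl)
           (auto simp: f_def \<phi>_def ind_def cis_cnj \<kappa>(2) algebra_simps)
      also have "\<dots> = b n * g n z + c n * ckernel \<alpha> (cnj (\<zeta> n)) z"
        using \<kappa>(4)[OF z] ind \<alpha> z integrable_mult_kernel[OF \<kappa>(1), of "\<lambda>t. cis (2 * pi * t)" z \<alpha>]
        by (subst Bochner_Integration.integral_add) auto
      finally show ?thesis .
    qed
    have "(\<lambda>x. cnj (\<phi> x)) \<in> borel_measurable P"
      by (rule borel_measurable_continuous_on[OF continuous_on_cnj[OF continuous_on_id] \<phi>_meas])
    then have int: "integrable P (\<lambda>x. f x * ckernel \<alpha> (cnj (\<phi> x)) z)"
      using f_P \<phi>_norm z \<alpha> by (intro integrable_mult_kernel) auto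
    have "(LINT x|P. 1 / (1 - cnj (\<phi> x) * z) powr of_real \<alpha> * f x) = (LINT x|P. f x * ckernel \<alpha> (cnj (\<phi> x)) z)"
      by (simp add: ckernel_def mult.commute)
    also have "\<dots> = (LINT n|count_space UNIV. LINT t|lborel. f (n, t) * ckernel \<alpha> (cnj (\<phi> (n, t))) z)"
      using integral_fst'[OF int[unfolded P_def]] by (simp add: P_def)
    also have "\<dots> = (\<Sum>n. b n * g n z + c n * ckernel \<alpha> (cnj (\<zeta> n)) z)"
      using integrable_fst'[OF int[unfolded P_def]] unfolding slice
      by (rule integral_count_space_nat)
    finally show "(\<Sum>n. b n * g n z + c n * ckernel \<alpha> (cnj (\<zeta> n)) z)
        = (LINT x|P. 1 / (1 - cnj (\<phi> x) * z) powr of_real \<alpha> * f x)" by simp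
  qed
qed

section \<open>From bounded variation to absolutely summable data, and part b)\<close>

lemma exists_circle_point_at_distance:
  assumes "0 \<le> r" "r \<le> 2"
  shows "\<exists>\<zeta>. cmod \<zeta> = 1 \<and> cmod (1 - \<zeta>) = r"
proof (intro exI conjI)
  \<comment> \<open>On the circle \<open>cmod (1 - \<zeta>)^2 = 2 - 2 * Re \<zeta>\<close>, which
    determines the real part.\<close>
  let ?\<zeta> = "Complex (1 - r\<^sup>2 / 2) (r * sqrt (1 - r\<^sup>2 / 4))"
  have "r\<^sup>2 \<le> 2\<^sup>2" using assms by (intro power_mono) auto
  then have sq: "(r * sqrt (1 - r\<^sup>2 / 4))\<^sup>2 = r\<^sup>2 * (1 - r\<^sup>2 / 4)"
    by (simp add: power_mult_distrib)
  have "(cmod ?\<zeta>)\<^sup>2 = 1" "(cmod (1 - ?\<zeta>))\<^sup>2 = r\<^sup>2"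
    by (simp_all add: cmod_power2 sq) (simp_all add: power2_eq_square algebra_simps)
  then show "cmod ?\<zeta> = 1" "cmod (1 - ?\<zeta>) = r"
    using assms power2_eq_imp_eq[of "cmod ?\<zeta>" 1] power2_eq_imp_eq[of "cmod (1 - ?\<zeta>)" r] by simp_all
qed

text \<open>From \<open>n = k\<close> on the series telescopes to \<open>x k - L\<close> with
  \<open>L\<close> the limit of \<open>x\<close>; the constant \<open>L\<close> is left over and
  gets a kernel of its own.\<close>

lemma bv_seq_step_expansion:
  assumes "x \<in> bv_seq"
  shows "\<exists>L. \<forall>k. (\<lambda>n. (x n - x (Suc n)) * (if k \<le> n then 1 else 0)) sums (x k - L)"
proof -
  have "summable (\<lambda>n. x (Suc n) - x n)"
    using assms unfolding bv_seq_def by (auto intro: summable_norm_cancel)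
  then have "convergent x" by (simp add: summable_iff_convergent sum_lessThan_telescope convergent_diff_const_right_iff)
  then obtain L where L: "x \<longlonglongrightarrow> L" by (auto simp: convergent_def)
  have "(\<lambda>n. (x n - x (Suc n)) * (if k \<le> n then 1 else 0)) sums (x k - L)" for k
  proof -
    have "(\<Sum>n<N. (x n - x (Suc n)) * (if k \<le> n then 1 else 0)) = x k - x N" if "k \<le> N" for N
      using that by (induction N rule: dec_induct) auto
    then have "\<forall>\<^sub>F N in sequentially. x k - x N = (\<Sum>n<N. (x n - x (Suc n)) * (if k \<le> n then 1 else 0))"
      by (auto simp: eventually_sequentially intro!: exI[of _ k])
    moreover have "(\<lambda>N. x k - x N) \<longlonglongrightarrow> x k - L" by (intro tendsto_intros L)
    ultimately show ?thesis unfolding sums_def by (rule Lim_transform_eventually[rotated])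
  qed
  then show ?thesis by blast
qed

context nc_stoltz
begin

lemma bv_seq_interpolation:
  assumes x: "x \<in> bv_seq"
  shows "\<exists>g\<in>F_space \<alpha>. \<forall>k. (1 - a k) powr of_real \<alpha> * g (a k) = x k"
proof -
  define c where "c n = x n - x (Suc n)" for n
  have c: "summable (\<lambda>n. cmod (c n))"
    using x by (simp add: bv_seq_def c_def norm_minus_commute)
  obtain L where L: "\<And>k. (\<lambda>n. c n * (if k \<le> n then 1 else 0)) sums (x k - L)"
    using bv_seq_step_expansion[OF x] unfolding c_def by blast
  \<comment> \<open>Distance \<open>d n\<close> from 1 allows the jump of the kernel to be placed
    between \<open>n\<close> and \<open>Suc n\<close>, where the \<open>n\<close>-th step function
    has it.\<close>
  have "\<forall>n. \<exists>\<zeta>. cmod \<zeta> = 1 \<and> cmod (1 - \<zeta>) = d n"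
    by (intro allI exists_circle_point_at_distance)
       (use d_pos in \<open>auto simp: less_imp_le intro: order_trans[OF d_le_1]\<close>)
  from choice[OF this] obtain \<zeta> where \<zeta>: "\<And>n. cmod (\<zeta> n) = 1" "\<And>n. cmod (1 - \<zeta> n) = d n"
    by blast
  define E where "E n k = (if k \<le> n then 1 else 0) - \<Phi> (\<zeta> n) k" for n k
  obtain B where B: "\<And>\<zeta> n N. \<lbrakk>cmod \<zeta> = 1; \<And>k. k < n \<Longrightarrow> cmod (1 - \<zeta>) \<le> d k; \<And>k. n \<le> k \<Longrightarrow> d k \<le> cmod (1 - \<zeta>)\<rbrakk> \<Longrightarrow>
     (\<Sum>k<N. cmod (\<Phi> \<zeta> k - (if k < n then 1 else 0))) \<le> B"
    using kernel_sums by blast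
  \<comment> \<open>By the equality \<open>cmod (1 - \<zeta> n) = d n\<close> the index
    \<open>n\<close> still counts as lying below the crossing, hence \<open>Suc n\<close>.\<close>
  have E: "(\<Sum>k<N. cmod (E n k)) \<le> B" for n N
    using B[of "\<zeta> n" "Suc n" N] \<zeta> d_antimono by (simp add: E_def norm_minus_commute less_Suc_eq_le)
  \<comment> \<open>The total error of replacing steps by kernels, which the localised functions
    have to correct.\<close>
  define y where "y k = (\<Sum>n. c n * E n k)" for k
  have y_sums: "(\<lambda>n. c n * E n k) sums y k" for k
    unfolding y_def using l1_operator(1)[OF c E] by (intro summable_sums summable_norm_cancel[of "\<lambda>n. c n * E n k"])
  have y: "summable (\<lambda>k. cmod (y k))"
    using l1_operator(2)[OF c E] by (intro summableI_nonneg_bounded) (auto simp: y_def)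
  obtain A g where g: "\<And>n. circle_density \<alpha> A (g n)" "\<And>n. (1 - a n) powr of_real \<alpha> * g n (a n) = 1"
      "\<And>n N. (\<Sum>k\<in>{..<N} - {n}. cmod ((1 - a k) powr of_real \<alpha> * g n (a k))) \<le> 1 / 2"
    using localized_functions by blast
  obtain b where b: "summable (\<lambda>n. cmod (b n))"
      and b_sums: "\<And>k. (\<lambda>n. b n * ((1 - a k) powr of_real \<alpha> * g n (a k))) sums y k"
    using l1_diagonally_dominant_solve[of "\<lambda>n k. (1 - a k) powr of_real \<alpha> * g n (a k)", OF g(2,3) y] by blast
  \<comment> \<open>Slot 0 carries the limit \<open>L\<close> at the point 1, where the normalised
    kernel is constantly 1; the kernels of the steps move up by one index.\<close>
  define c' where "c' n = (case n of 0 \<Rightarrow> L | Suc m \<Rightarrow> c m)" for n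
  define \<zeta>' where "\<zeta>' n = (case n of 0 \<Rightarrow> 1 | Suc m \<Rightarrow> \<zeta> m)" for n
  define G where "G z = (\<Sum>n. b n * g n z + c' n * ckernel \<alpha> (cnj (\<zeta>' n)) z)" for z
  have c': "summable (\<lambda>n. cmod (c' n))"
    using c by (subst summable_Suc_iff[symmetric]) (simp add: c'_def)
  have "G \<in> F_space \<alpha>"
    unfolding G_def by (rule F_space_series[OF \<alpha> g(1) b c']) (auto simp: \<zeta>'_def \<zeta> split: nat.split)
  moreover have "(1 - a k) powr of_real \<alpha> * G (a k) = x k" for k
  proof -
    have "(\<lambda>n. c n * (if k \<le> n then 1 else 0) - c n * E n k) sums (x k - L - y k)"
      by (intro sums_diff L y_sums)
    then have "(\<lambda>n. c n * \<Phi> (\<zeta> n) k) sums (x k - L - y k)"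
      by (simp add: E_def right_diff_distrib)
    then have "(\<lambda>n. c' (Suc n) * \<Phi> (\<zeta>' (Suc n)) k) sums (x k - L - y k)"
      by (simp add: c'_def \<zeta>'_def)
    from sums_Suc[OF this] have "(\<lambda>n. c' n * \<Phi> (\<zeta>' n) k) sums (x k - y k)"
      by (simp add: c'_def \<zeta>'_def \<Phi>_one)
    from sums_add[OF b_sums[of k] this]
    have sums: "(\<lambda>n. (1 - a k) powr of_real \<alpha> * (b n * g n (a k) + c' n * ckernel \<alpha> (cnj (\<zeta>' n)) (a k))) sums x k"
      by (simp add: \<Phi>_def ckernel_def algebra_simps)
    have nz: "(1 - a k) powr of_real \<alpha> \<noteq> 0" using disc[of k] by auto
    have "summable (\<lambda>n. b n * g n (a k) + c' n * ckernel \<alpha> (cnj (\<zeta>' n)) (a k))"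
      using sums_summable[OF sums] nz by (simp add: summable_cmult_iff)
    then have "(1 - a k) powr of_real \<alpha> * G (a k)
        = (\<Sum>n. (1 - a k) powr of_real \<alpha> * (b n * g n (a k) + c' n * ckernel \<alpha> (cnj (\<zeta>' n)) (a k)))"
      unfolding G_def by (rule suminf_mult[symmetric])
    then show ?thesis using sums_unique[OF sums] by simp
  qed
  ultimately show ?thesis by blast
qed

end

text \<open>The partial products lie in \<open>[0, 1]\<close> and decrease, so \<open>lim\<close> in
  \<open>nc_delta\<close> is a genuine limit, the infimum is over a set bounded below, and
  \<open>nc_delta a\<close> bounds every partial product from below. The locale assumes this finite
  form, which keeps limits out of its estimates.\<close>

lemma nc_stoltz_of_newman_carleson:
  fixes \<alpha> :: real and a :: "nat \<Rightarrow> complex"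
  assumes \<alpha>: "\<alpha> > 0" and disc: "\<And>k. a k \<in> ball 0 1"
    and mono: "\<And>k. cmod (a k) \<le> cmod (a (Suc k))"
    and nc: "newman_carleson a" and st: "stoltz a"
  shows "\<exists>C. nc_stoltz a C (nc_delta a) \<alpha>"
proof -
  have disc': "cmod (a k) < 1" for k using disc[of k] by simp
  obtain C where C: "\<And>k. cmod (1 - a k) / (1 - cmod (a k)) \<le> C"
    using st unfolding stoltz_def bdd_above_def by auto
  define r where "r k n = cmod ((a k - a n) / (1 - cnj (a k) * a n))" for k n
  have r: "0 \<le> r k n" "r k n \<le> 1" for k n
  proof -
    have "(1 - (cmod (a k))\<^sup>2) * (1 - (cmod (a n))\<^sup>2) \<ge> 0"
      using disc'[of k] disc'[of n] by (intro mult_nonneg_nonneg) (auto simp: power_le_one)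
    then have "(cmod (a k - a n))\<^sup>2 \<le> (cmod (1 - cnj (a k) * a n))\<^sup>2"
      using cmod_power2_diff[of "a k" "a n"] by linarith
    then have "cmod (a k - a n) \<le> cmod (1 - cnj (a k) * a n)"
      by (rule power2_le_imp_le) simp
    then show "0 \<le> r k n" "r k n \<le> 1" by (auto simp: r_def norm_divide divide_le_eq_1)
  qed
  define p where "p n N = (\<Prod>k\<in>{..<N} - {n}. r k n)" for n N
  have p_nonneg: "0 \<le> p n N" for n N unfolding p_def using r by (intro prod_nonneg) auto
  have dec: "decseq (p n)" for n
  proof (rule decseq_SucI)
    fix N
    \<comment> \<open>Passing \<open>N = n\<close> adds no index, hence the factor 1 there.\<close>
    have "p n (Suc N) \<le> p n N * (if N = n then 1 else r N n)"
      by (auto simp: p_def lessThan_Suc insert_Diff_if)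
    also have "\<dots> \<le> p n N * 1" using r p_nonneg by (intro mult_left_mono) auto
    finally show "p n (Suc N) \<le> p n N" by simp
  qed
  have conv: "p n \<longlonglongrightarrow> lim (p n)" for n
  proof -
    obtain l where "p n \<longlonglongrightarrow> l" using decseq_convergent[OF dec] p_nonneg by metis
    then show ?thesis by (simp add: limI)
  qed
  have lim_nonneg: "0 \<le> lim (p n)" for n
    by (rule LIMSEQ_le_const[OF conv]) (use p_nonneg in auto)
  have "nc_delta a \<le> p n N" for n N
  proof -
    have "nc_delta a = (INF n. lim (p n))"
      by (simp add: nc_delta_def p_def[abs_def] r_def)
    also have "\<dots> \<le> lim (p n)"
      by (rule cINF_lower) (use lim_nonneg in \<open>auto intro!: bdd_belowI[of _ 0]\<close>)
    also have "\<dots> \<le> p n N" by (rule decseq_ge[OF dec conv])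
    finally show ?thesis .
  qed
  then have "nc_stoltz a C (nc_delta a) \<alpha>"
    using \<alpha> disc' C nc lift_Suc_mono_le[of "\<lambda>k. cmod (a k)", OF mono]
    by unfold_locales (auto simp: newman_carleson_def p_def r_def field_simps)
  then show ?thesis by blast
qed

theorem theorem2:
  fixes \<alpha> :: real and a :: "nat \<Rightarrow> complex"
  assumes "\<alpha> > 0"
    and "\<And>k. a k \<in> ball 0 1"
    and "\<And>k n. k \<noteq> n \<Longrightarrow> a k \<noteq> a n"
    and "\<And>k. cmod (a k) \<le> cmod (a (Suc k))"
    and "newman_carleson a"
    and "stoltz a"
  shows "(\<forall>g\<in>F_space \<alpha>. (\<lambda>k. (1 - a k) powr of_real \<alpha> * g (a k)) \<in> bv_seq) \<and>
         (\<forall>x\<in>bv_seq. \<exists>g\<in>F_space \<alpha>. \<forall>k. (1 - a k) powr of_real \<alpha> * g (a k) = x k)"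
proof -
  obtain C where "nc_stoltz a C (nc_delta a) \<alpha>"
    using nc_stoltz_of_newman_carleson assms by blast
  then interpret nc_stoltz a C "nc_delta a" \<alpha> .
  show ?thesis using F_space_imp_bv_seq bv_seq_interpolation by blast
qed

end
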